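(* Let $\hat{e}=(e_n,e_n^\star)$ be the standard unit vectors with their coordinate functionals, and let $\mathfrak{J}$ be the James space. The following are equivalent for any nontrivial ideal $\mathcal{I}$ on $\omega$: (a) there is $\hat{a}\subseteq c_0\times c_0^\star$ simple over $\hat{e}$ such that $\mathcal{CR}(c_0,\hat{a})=\mathcal{I}$; (b) there is $\hat{a}\subseteq\mathfrak{J}\times\mathfrak{J}^\star$ simple over $\hat{e}$ such that $\mathcal{CR}(\mathfrak{J},\hat{a})=\mathcal{I}$; (c) $\mathcal{I}$ is isomorphic to one of the following ideals: $\mathrm{Fin}$, $\mathrm{Fin}\oplus\mathcal{P}(\omega)$ or $\{\emptyset\}\otimes\mathrm{Fin}$.
   Context: $\omega=\{0,1,2,\dots\}$. An ideal on a countable set $M$ is a family $\mathcal{I}\subseteq\mathcal{P}(M)$ containing all finite sets and closed under subsets and finite unions; it is nontrivial if $\mathcal{I}\ne\mathcal{P}(M)$. $\mathrm{Fin}$ is the ideal of finite subsets of $\omega$. $\mathrm{Fin}\oplus\mathcal{P}(\omega)$ is the ideal on $\{0,1\}\times\omega$ of all $A$ such that $A\cap(\{0\}\times\omega)$ is finite. $\{\emptyset\}\otimes\mathrm{Fin}$ is the ideal on $\omega\times\omega$ of all $A$ such that $\{k:(n,k)\in A\}$ is finite for every $n\in\omega$. Ideals $\mathcal{I}$ on $M$ and $\mathcal{J}$ on $N$ are isomorphic if there is a bijection $f:N\to M$ with $f^{-1}[A]\in\mathcal{J}\Leftrightarrow A\in\mathcal{I}$ for all $A\subseteq M$. The James space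 $\mathfrak{J}$ is the Banach space of all real sequences $x\in c_0$ with $\|x\|_{\mathfrak{J}}=\sup\{(\sum_{i=1}^n(x_{p_i}-x_{p_{i-1}})^2)^{1/2}:n\in\omega,\ 0\le p_0<p_1<\dots<p_n\}<\infty$, with this norm; $\hat{e}$ is a Schauder basis of $c_0$ and of $\mathfrak{J}$. Let $X$ be a Banach space with scalar field $\mathbb{K}$ and continuous dual $X^\star$. All sequences of pairs $\hat{a}=(a_n,a_n^\star)_{n\in\omega}$ with $a_n\in X$, $a_n^\star:X\to\mathbb{K}$ are assumed biorthogonal: $a_n^\star(a_m)=\delta_{nm}$. Put $S_n(\hat{a})(x)=\sum_{i=0}^n a_i^\star(x)a_i$. For an ideal $\mathcal{I}$ on $\omega$, $\hat{a}$ is an $\mathcal{I}$-Schauder basis of $X$ if $\{n\in\omega:\|x-S_n(\hat{a})(x)\|_X\ge\varepsilon\}\in\mathcal{I}$ for all $x\in X$, $\varepsilon>0$. The critical ideal $\mathcal{CR}(X,\hat{a})$ is the (unique, possibly trivial) ideal on $\omega$ such that for every ideal $\mathcal{I}$ on $\omega$: $\hat{a}$ is an $\mathcal{I}$-Schauder basis of $X$ iff $\mathcal{CR}(X,\hat{a})\subseteq\mathcal{I}$. $\hat{a}\subseteq X\times X^\star$ is simple over $\hat{u}\subseteq X\times X^\star$ if there are $D\subseteq\omega$, a function $h:D\to\omega$ that is interval-to-one (each $h^{-1}[\{k\}]$ is empty or an interval of $\omega$ contained in $D$), and vectors $(b_k)_{k\in h[D]}\subseteq X\setminus\{0\}$ such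 that for all $x\in X$: $S_n(\hat{u})(x)-S_n(\hat{a})(x)=0$ if $n\in\omega\setminus D$, and $=u_{h(n)}^\star(x)\,b_{h(n)}$ if $n\in D$. *)

theory Defs
  imports "HOL-Analysis.Analysis"
begin

section \<open>Ideals on sets\<close>

definition ideal_on :: "'m set \<Rightarrow> 'm set set \<Rightarrow> bool" where
  "ideal_on M I \<longleftrightarrow> I \<subseteq> Pow M
     \<and> (\<forall>A. A \<subseteq> M \<and> finite A \<longrightarrow> A \<in> I)
     \<and> (\<forall>A B. A \<in> I \<and> B \<subseteq> A \<longrightarrow> B \<in> I)
     \<and> (\<forall>A B. A \<in> I \<and> B \<in> I \<longrightarrow> A \<union> B \<in> I)"

definition ideal_isomorphic :: "'m set \<Rightarrow> 'm set set \<Rightarrow> 'n set \<Rightarrow> 'n set set \<Rightarrow> bool" where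
  "ideal_isomorphic M I N J \<longleftrightarrow>
     (\<exists>f. bij_betw f N M \<and> (\<forall>A. A \<subseteq> M \<longrightarrow> (f -` A \<inter> N \<in> J \<longleftrightarrow> A \<in> I)))"

definition Fin_ideal :: "nat set set" where
  "Fin_ideal = {A. finite A}"

text \<open>An ideal on \<^term>\<open>{0, 1} \<times> UNIV\<close>.\<close>

definition Fin_oplus_Pow :: "(nat \<times> nat) set set" where
  "Fin_oplus_Pow = {A. A \<subseteq> {0, 1} \<times> UNIV \<and> finite (A \<inter> {0} \<times> UNIV)}"

definition empty_otimes_Fin :: "(nat \<times> nat) set set" where
  "empty_otimes_Fin = {A. \<forall>n. finite {k. (n, k) \<in> A}}"

lemma ideal_on_Fin_ideal: "ideal_on UNIV Fin_ideal"
  by (auto simp: ideal_on_def Fin_ideal_def intro: finite_subset)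

lemma ideal_on_Fin_oplus_Pow: "ideal_on ({0, 1} \<times> UNIV) Fin_oplus_Pow"
proof -
  have "finite (B \<inter> {0} \<times> UNIV)" if "finite (A \<inter> {0} \<times> UNIV)" "B \<subseteq> A" for A B :: "(nat \<times> nat) set"
    using that by (meson Int_mono finite_subset subset_refl)
  then show ?thesis
    by (auto simp: ideal_on_def Fin_oplus_Pow_def Int_Un_distrib2)
qed

lemma ideal_on_empty_otimes_Fin: "ideal_on UNIV empty_otimes_Fin"
proof -
  have "finite {k. (n, k) \<in> A}" if "finite A" for n and A :: "(nat \<times> nat) set"
  proof -
    have "{k. (n, k) \<in> A} \<subseteq> snd ` A" by force
    then show ?thesis using that by (meson finite_imageI finite_subset)
  qed
  moreover have "finite {k. (n, k) \<in> B}" if "\<forall>n. finite {k. (n, k) \<in> A}" "B \<subseteq> A" for n and A B :: "(nat \<times> nat) set"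
    by (rule finite_subset[of _ "{k. (n, k) \<in> A}"]) (use that in auto)
  ultimately show ?thesis
    by (auto simp: ideal_on_def empty_otimes_Fin_def Collect_disj_eq)
qed


section \<open>Biorthogonal sequences, ideal Schauder bases and the critical ideal\<close>

text \<open>
  A set of naturals is an interval iff it is order-convex; the empty set and unbounded
  intervals are included.
\<close>

definition nat_interval :: "nat set \<Rightarrow> bool" where
  "nat_interval S \<longleftrightarrow> (\<forall>i\<in>S. \<forall>j\<in>S. {i..j} \<subseteq> S)"

text \<open>
  Banach spaces over a scalar field \<open>'k\<close> that is either the reals or the complex numbers: a real
  normed field (with multiplicative norm) is isometrically isomorphic to one of these two by
  the Gelfand--Mazur theorem. The library's real vector space structure on \<open>'a\<close> is required
  to be the restriction of the \<open>'k\<close>-structure given by \<open>scale\<close>.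
\<close>

locale banach_space_over = vector_space scale
  for scale :: "'k::{real_normed_field,banach} \<Rightarrow> 'a::banach \<Rightarrow> 'a" +
  assumes norm_scale: "norm (scale c x) = norm c * norm x"
    and scale_of_real: "scale (of_real r) x = r *\<^sub>R x"
begin

definition continuous_dual :: "('a \<Rightarrow> 'k) set" where
  "continuous_dual = {f. Vector_Spaces.linear scale (*) f \<and> continuous_on UNIV f}"

definition biorthogonal :: "(nat \<Rightarrow> 'a \<times> ('a \<Rightarrow> 'k)) \<Rightarrow> bool" where
  "biorthogonal a \<longleftrightarrow> (\<forall>n m. snd (a n) (fst (a m)) = (if n = m then 1 else 0))"

definition partial_sum :: "(nat \<Rightarrow> 'a \<times> ('a \<Rightarrow> 'k)) \<Rightarrow> nat \<Rightarrow> 'a \<Rightarrow> 'a" where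
  "partial_sum a n x = (\<Sum>i=0..n. scale (snd (a i) x) (fst (a i)))"

definition ideal_Schauder_basis :: "nat set set \<Rightarrow> (nat \<Rightarrow> 'a \<times> ('a \<Rightarrow> 'k)) \<Rightarrow> bool" where
  "ideal_Schauder_basis I a \<longleftrightarrow>
     (\<forall>x. \<forall>\<epsilon>>0. {n. norm (x - partial_sum a n x) \<ge> \<epsilon>} \<in> I)"

definition is_critical_ideal :: "(nat \<Rightarrow> 'a \<times> ('a \<Rightarrow> 'k)) \<Rightarrow> nat set set \<Rightarrow> bool" where
  "is_critical_ideal a C \<longleftrightarrow> ideal_on UNIV C \<and>
     (\<forall>I. ideal_on UNIV I \<longrightarrow> (ideal_Schauder_basis I a \<longleftrightarrow> C \<subseteq> I))"

definition critical_ideal :: "(nat \<Rightarrow> 'a \<times> ('a \<Rightarrow> 'k)) \<Rightarrow> nat set set" where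
  "critical_ideal a = (THE C. is_critical_ideal a C)"

lemma ex1_critical_ideal: "\<exists>!C. is_critical_ideal a C"
proof -
  define F where "F = {I. ideal_on UNIV I \<and> ideal_Schauder_basis I a}"
  have F: "ideal_on UNIV I" "ideal_Schauder_basis I a" if "I \<in> F" for I
    using that by (simp_all add: F_def)
  have ideal: "ideal_on UNIV (\<Inter>F)"
    unfolding ideal_on_def
  proof (intro conjI allI impI)
    show "A \<in> \<Inter>F" if "A \<subseteq> UNIV \<and> finite A" for A
    proof
      fix I assume "I \<in> F"
      then show "A \<in> I" using F(1)[of I] that by (simp add: ideal_on_def)
    qed
    show "B \<in> \<Inter>F" if "A \<in> \<Inter>F \<and> B \<subseteq> A" for A B
    proof
      fix I assume I: "I \<in> F"
      then have "A \<in> I" using that by blast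
      then show "B \<in> I" using F(1)[OF I] that unfolding ideal_on_def by metis
    qed
    show "A \<union> B \<in> \<Inter>F" if "A \<in> \<Inter>F \<and> B \<in> \<Inter>F" for A B
    proof
      fix I assume I: "I \<in> F"
      then have "A \<in> I" "B \<in> I" using that by blast+
      then show "A \<union> B \<in> I" using F(1)[OF I] by (simp add: ideal_on_def)
    qed
  qed simp
  have basis: "ideal_Schauder_basis (\<Inter>F) a"
    using F(2) by (simp add: ideal_Schauder_basis_def)
  have mono: "ideal_Schauder_basis I a" if "ideal_Schauder_basis J a" "J \<subseteq> I" for I J
    using that by (simp add: ideal_Schauder_basis_def subset_iff)
  show ?thesis
  proof (rule ex1I)
    show "is_critical_ideal a (\<Inter>F)"
      unfolding is_critical_ideal_def
    proof (intro conjI allI impI ideal)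
      fix I :: "nat set set" assume I: "ideal_on UNIV I"
      show "ideal_Schauder_basis I a \<longleftrightarrow> \<Inter>F \<subseteq> I"
      proof
        assume "ideal_Schauder_basis I a"
        then have "I \<in> F" using I by (simp add: F_def)
        then show "\<Inter>F \<subseteq> I" by (rule Inter_lower)
      qed (rule mono[OF basis])
    qed
  next
    fix C assume C: "is_critical_ideal a C"
    then have CF: "C \<in> F" by (simp add: is_critical_ideal_def F_def)
    show "C = \<Inter>F"
    proof (rule antisym)
      show "C \<subseteq> \<Inter>F" using C ideal basis by (simp add: is_critical_ideal_def)
      show "\<Inter>F \<subseteq> C" using CF by (rule Inter_lower)
    qed
  qed
qed

definition simple_over ::
    "(nat \<Rightarrow> 'a \<times> ('a \<Rightarrow> 'k)) \<Rightarrow> (nat \<Rightarrow> 'a \<times> ('a \<Rightarrow> 'k)) \<Rightarrow> bool" where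
  "simple_over a u \<longleftrightarrow>
     biorthogonal a \<and> range a \<subseteq> UNIV \<times> continuous_dual \<and>
     biorthogonal u \<and> range u \<subseteq> UNIV \<times> continuous_dual \<and>
     (\<exists>D (h :: nat \<Rightarrow> nat) (b :: nat \<Rightarrow> 'a).
        (\<forall>k. nat_interval {n \<in> D. h n = k}) \<and>
        (\<forall>k \<in> h ` D. b k \<noteq> 0) \<and>
        (\<forall>x n. partial_sum u n x - partial_sum a n x =
                 (if n \<in> D then scale (snd (u (h n)) x) (b (h n)) else 0)))"

end


section \<open>The space of null sequences\<close>

typedef (overloaded) 'k c0 = "{x :: nat \<Rightarrow> 'k::real_normed_field. x \<longlonglongrightarrow> 0}"
  morphisms c0_coord Abs_c0
  by (rule exI[of _ "\<lambda>_. 0"]) simp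

setup_lifting type_definition_c0

lemma c0_coord_tendsto: "c0_coord x \<longlonglongrightarrow> 0"
  using c0_coord[of x] by simp

lemma cSUP_mult_left:
  fixes f :: "nat \<Rightarrow> real"
  assumes "0 \<le> c" "bdd_above (range f)"
  shows "(SUP n. c * f n) = c * (SUP n. f n)"
proof -
  have "mono ((*) c)" using assms by (simp add: mono_def mult_left_mono)
  moreover have "continuous (at_left (SUP n. f n)) ((*) c)" by (intro continuous_intros)
  ultimately show ?thesis
    using continuous_at_Sup_mono[of "(*) c" "range f"] assms(2) by (simp add: image_comp o_def)
qed

lemma null_sequence_bdd:
  fixes x :: "nat \<Rightarrow> 'k::real_normed_field"
  assumes "x \<longlonglongrightarrow> 0"
  shows "bdd_above (range (\<lambda>n. norm (x n)))"
proof -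
  have "Bseq x" using assms by (meson convergentI convergent_imp_Bseq)
  then show ?thesis unfolding Bseq_def bdd_above_def by blast
qed

instantiation c0 :: (real_normed_field) real_normed_vector
begin

lift_definition zero_c0 :: "'a c0" is "\<lambda>_. 0" by simp
lift_definition plus_c0 :: "'a c0 \<Rightarrow> 'a c0 \<Rightarrow> 'a c0" is "\<lambda>x y n. x n + y n"
  using tendsto_add_zero by blast
lift_definition minus_c0 :: "'a c0 \<Rightarrow> 'a c0 \<Rightarrow> 'a c0" is "\<lambda>x y n. x n - y n"
  using tendsto_diff by fastforce
lift_definition uminus_c0 :: "'a c0 \<Rightarrow> 'a c0" is "\<lambda>x n. - x n"
  using tendsto_minus by fastforce
lift_definition scaleR_c0 :: "real \<Rightarrow> 'a c0 \<Rightarrow> 'a c0" is "\<lambda>r x n. r *\<^sub>R x n"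
  using tendsto_scaleR[OF tendsto_const] by fastforce
lift_definition norm_c0 :: "'a c0 \<Rightarrow> real" is "\<lambda>x. SUP n. norm (x n)" .

definition dist_c0 :: "'a c0 \<Rightarrow> 'a c0 \<Rightarrow> real" where "dist_c0 x y = norm (x - y)"
definition sgn_c0 :: "'a c0 \<Rightarrow> 'a c0" where "sgn_c0 x = inverse (norm x) *\<^sub>R x"
definition uniformity_c0 :: "('a c0 \<times> 'a c0) filter" where
  "uniformity_c0 = (INF e\<in>{0<..}. principal {(x, y). dist x y < e})"
definition open_c0 :: "'a c0 set \<Rightarrow> bool" where
  "open_c0 U \<longleftrightarrow> (\<forall>x\<in>U. \<forall>\<^sub>F (x', y) in uniformity. x' = x \<longrightarrow> y \<in> U)"

instance
proof
  fix x y z :: "'a c0" and r s :: real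
  show "x + y + z = x + (y + z)" by transfer (simp add: add.assoc)
  show "x + y = y + x" by transfer (simp add: add.commute)
  show "0 + x = x" by transfer simp
  show "- x + x = 0" by transfer simp
  show "x - y = x + - y" by transfer simp
  show "r *\<^sub>R (x + y) = r *\<^sub>R x + r *\<^sub>R y" by transfer (simp add: scaleR_add_right)
  show "(r + s) *\<^sub>R x = r *\<^sub>R x + s *\<^sub>R x" by transfer (simp add: scaleR_add_left)
  show "r *\<^sub>R s *\<^sub>R x = (r * s) *\<^sub>R x" by transfer simp
  show "1 *\<^sub>R x = x" by transfer simp
  show "dist x y = norm (x - y)" by (rule dist_c0_def)
  show "sgn x = inverse (norm x) *\<^sub>R x" by (rule sgn_c0_def)
  show "uniformity = (INF e\<in>{0<..}. principal {(x, y :: 'a c0). dist x y < e})"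
    by (rule uniformity_c0_def)
  show "open U \<longleftrightarrow> (\<forall>x\<in>U. \<forall>\<^sub>F (x', y) in uniformity. x' = x \<longrightarrow> y \<in> U)" for U :: "'a c0 set"
    by (rule open_c0_def)
  show "norm x = 0 \<longleftrightarrow> x = 0"
  proof transfer
    fix x :: "nat \<Rightarrow> 'a" assume x: "x \<longlonglongrightarrow> 0"
    show "(SUP n. norm (x n)) = 0 \<longleftrightarrow> x = (\<lambda>_. 0)"
    proof
      assume sup: "(SUP n. norm (x n)) = 0"
      have "norm (x n) \<le> 0" for n
        using cSUP_upper[OF UNIV_I null_sequence_bdd[OF x], of n] sup by simp
      then show "x = (\<lambda>_. 0)" by auto
    qed simp
  qed
  show "norm (x + y) \<le> norm x + norm y"
  proof transfer
    fix x y :: "nat \<Rightarrow> 'a" assume x: "x \<longlonglongrightarrow> 0" and y: "y \<longlonglongrightarrow> 0"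
    show "(SUP n. norm (x n + y n)) \<le> (SUP n. norm (x n)) + (SUP n. norm (y n))"
    proof (rule cSUP_least)
      fix n
      show "norm (x n + y n) \<le> (SUP n. norm (x n)) + (SUP n. norm (y n))"
        using cSUP_upper[OF UNIV_I null_sequence_bdd[OF x], of n]
          cSUP_upper[OF UNIV_I null_sequence_bdd[OF y], of n] norm_triangle_ineq[of "x n" "y n"]
        by linarith
    qed simp
  qed
  show "norm (r *\<^sub>R x) = \<bar>r\<bar> * norm x"
  proof transfer
    fix r :: real and x :: "nat \<Rightarrow> 'a" assume x: "x \<longlonglongrightarrow> 0"
    show "(SUP n. norm (r *\<^sub>R x n)) = \<bar>r\<bar> * (SUP n. norm (x n))"
      by (simp add: cSUP_mult_left null_sequence_bdd[OF x])
  qed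
qed

end

lemma norm_c0_coord_le: "norm (c0_coord x n) \<le> norm x"
  unfolding norm_c0.rep_eq by (rule cSUP_upper[OF UNIV_I null_sequence_bdd[OF c0_coord_tendsto]])

lemma norm_c0_le: "(\<And>n. norm (c0_coord x n) \<le> b) \<Longrightarrow> norm x \<le> b"
  unfolding norm_c0.rep_eq by (rule cSUP_least) auto

instance c0 :: ("{real_normed_field,banach}") banach
proof
  fix X :: "nat \<Rightarrow> 'a c0" assume X: "Cauchy X"
  have le: "norm (c0_coord (X m) k - c0_coord (X n) k) \<le> norm (X m - X n)" for m n k
    using norm_c0_coord_le[of "X m - X n" k] by (simp add: minus_c0.rep_eq)
  have "Cauchy (\<lambda>n. c0_coord (X n) k)" for k
    unfolding Cauchy_iff
  proof (intro allI impI)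
    fix e :: real assume "0 < e"
    then obtain M where M: "\<forall>m\<ge>M. \<forall>n\<ge>M. norm (X m - X n) < e"
      using X unfolding Cauchy_iff by blast
    show "\<exists>M. \<forall>m\<ge>M. \<forall>n\<ge>M. norm (c0_coord (X m) k - c0_coord (X n) k) < e"
    proof (intro exI[of _ M] allI impI)
      fix m n assume "M \<le> m" "M \<le> n"
      then have "norm (X m - X n) < e" using M by blast
      then show "norm (c0_coord (X m) k - c0_coord (X n) k) < e" using le[of m k n] by simp
    qed
  qed
  then have conv: "(\<lambda>n. c0_coord (X n) k) \<longlonglongrightarrow> lim (\<lambda>n. c0_coord (X n) k)" for k
    by (simp add: Cauchy_convergent_iff convergent_LIMSEQ_iff)
  define y where "y k = lim (\<lambda>n. c0_coord (X n) k)" for k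
  have unif: "\<exists>N. \<forall>n\<ge>N. \<forall>k. norm (c0_coord (X n) k - y k) \<le> e" if "0 < e" for e
  proof -
    obtain N where N: "\<And>m n. m \<ge> N \<Longrightarrow> n \<ge> N \<Longrightarrow> norm (X m - X n) < e"
      using X \<open>0 < e\<close> unfolding Cauchy_iff by blast
    have "norm (c0_coord (X n) k - y k) \<le> e" if "n \<ge> N" for n k
    proof (rule tendsto_upperbound)
      show "(\<lambda>m. norm (c0_coord (X n) k - c0_coord (X m) k)) \<longlonglongrightarrow> norm (c0_coord (X n) k - y k)"
        unfolding y_def by (intro tendsto_intros conv)
      have "norm (c0_coord (X n) k - c0_coord (X m) k) \<le> e" if "m \<ge> N" for m
        using N[OF \<open>n \<ge> N\<close> that] le[of n k m] by linarith
      then show "\<forall>\<^sub>F m in sequentially. norm (c0_coord (X n) k - c0_coord (X m) k) \<le> e"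
        unfolding eventually_sequentially by blast
    qed simp
    then show ?thesis by blast
  qed
  have "y \<longlonglongrightarrow> 0"
    unfolding LIMSEQ_iff
  proof (intro allI impI)
    fix e :: real assume "0 < e"
    then obtain N where N: "\<And>k. norm (c0_coord (X N) k - y k) \<le> e / 2"
      using unif[of "e / 2"] by auto
    obtain K where K: "\<And>k. k \<ge> K \<Longrightarrow> norm (c0_coord (X N) k) < e / 2"
      using LIMSEQ_D[OF c0_coord_tendsto[of "X N"], of "e / 2"] \<open>0 < e\<close> by auto
    have "norm (y k - 0) < e" if "k \<ge> K" for k
      using norm_triangle_ineq4[of "c0_coord (X N) k" "c0_coord (X N) k - y k"] N[of k] K[OF that] by simp
    then show "\<exists>K. \<forall>k\<ge>K. norm (y k - 0) < e" by blast
  qed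
  then have y: "c0_coord (Abs_c0 y) = y" by (simp add: Abs_c0_inverse)
  have "X \<longlonglongrightarrow> Abs_c0 y"
    unfolding LIMSEQ_iff
  proof (intro allI impI)
    fix e :: real assume "0 < e"
    then obtain N where N: "\<And>n k. n \<ge> N \<Longrightarrow> norm (c0_coord (X n) k - y k) \<le> e / 2"
      using unif[of "e / 2"] by auto
    have "norm (X n - Abs_c0 y) < e" if "n \<ge> N" for n
    proof -
      have "norm (X n - Abs_c0 y) \<le> e / 2"
        by (rule norm_c0_le) (unfold minus_c0.rep_eq y, rule N[OF that])
      then show ?thesis using \<open>0 < e\<close> by simp
    qed
    then show "\<exists>N. \<forall>n\<ge>N. norm (X n - Abs_c0 y) < e" by blast
  qed
  then show "convergent X" by (rule convergentI)
qed

lift_definition c0_scale :: "'k::real_normed_field \<Rightarrow> 'k c0 \<Rightarrow> 'k c0" is "\<lambda>c x n. c * x n"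
  using tendsto_mult_right_zero by blast

global_interpretation c0: banach_space_over
  "c0_scale :: 'k::{real_normed_field,banach} \<Rightarrow> 'k c0 \<Rightarrow> 'k c0"
proof
  fix c d :: 'k and x y :: "'k c0" and r :: real
  show "c0_scale c (x + y) = c0_scale c x + c0_scale c y" by transfer (simp add: distrib_left)
  show "c0_scale (c + d) x = c0_scale c x + c0_scale d x" by transfer (simp add: distrib_right)
  show "c0_scale c (c0_scale d x) = c0_scale (c * d) x" by transfer (simp add: mult.assoc)
  show "c0_scale 1 x = x" by transfer simp
  show "c0_scale (of_real r) x = r *\<^sub>R x" by transfer (simp add: scaleR_conv_of_real)
  show "norm (c0_scale c x) = norm c * norm x"
  proof transfer
    fix c :: 'k and x :: "nat \<Rightarrow> 'k" assume x: "x \<longlonglongrightarrow> 0"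
    show "(SUP n. norm (c * x n)) = norm c * (SUP n. norm (x n))"
      by (simp add: norm_mult cSUP_mult_left null_sequence_bdd[OF x])
  qed
qed

lift_definition c0_unit_vector :: "nat \<Rightarrow> 'k::real_normed_field c0" is
  "\<lambda>n k. if k = n then 1 else 0"
proof -
  fix n :: nat
  show "(\<lambda>k. if k = n then 1 else (0::'k)) \<longlonglongrightarrow> 0"
    by (rule tendsto_eventually) (auto simp: eventually_sequentially intro!: exI[of _ "Suc n"])
qed

definition c0_unit :: "nat \<Rightarrow> 'k c0 \<times> ('k c0 \<Rightarrow> 'k::{real_normed_field,banach})" where
  "c0_unit n = (c0_unit_vector n, \<lambda>x. c0_coord x n)"

lemma c0_unit_biorthogonal: "c0.biorthogonal c0_unit"
  by (simp add: c0.biorthogonal_def c0_unit_def c0_unit_vector.rep_eq)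

lemma c0_unit_dual: "range (c0_unit :: nat \<Rightarrow> 'k c0 \<times> _)
    \<subseteq> UNIV \<times> (c0.continuous_dual :: ('k c0 \<Rightarrow> 'k::{real_normed_field,banach}) set)"
proof -
  have "Vector_Spaces.linear c0_scale (*) (\<lambda>x :: 'k c0. c0_coord x n)" for n
    by unfold_locales
      (simp_all add: algebra_simps plus_c0.rep_eq c0_scale.rep_eq)
  moreover have "continuous_on UNIV (\<lambda>x :: 'k c0. c0_coord x n)" for n
  proof -
    have "bounded_linear (\<lambda>x :: 'k c0. c0_coord x n)"
      by (rule bounded_linear_intro[where K = 1])
        (simp_all add: plus_c0.rep_eq scaleR_c0.rep_eq norm_c0_coord_le)
    then show ?thesis by (rule linear_continuous_on)
  qed
  ultimately show ?thesis by (auto simp: c0.continuous_dual_def c0_unit_def)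
qed


section \<open>The James space\<close>

definition james_var :: "(nat \<Rightarrow> real) \<Rightarrow> nat \<Rightarrow> (nat \<Rightarrow> nat) \<Rightarrow> real" where
  "james_var x n p = sqrt (\<Sum>i=1..n. (x (p i) - x (p (i - 1)))\<^sup>2)"

definition james_variations :: "(nat \<Rightarrow> real) \<Rightarrow> real set" where
  "james_variations x = {james_var x n p | n p. strict_mono_on {0..n} p}"

typedef james = "{x :: nat \<Rightarrow> real. x \<longlonglongrightarrow> 0 \<and> bdd_above (james_variations x)}"
  morphisms james_coord Abs_james
proof (rule exI[of _ "\<lambda>_. 0"])
  have "james_variations (\<lambda>_. 0) \<subseteq> {0}" by (auto simp: james_variations_def james_var_def)
  then have "bdd_above (james_variations (\<lambda>_. 0))" by (intro bdd_aboveI[of _ 0]) auto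
  then show "(\<lambda>_. 0) \<in> {x. x \<longlonglongrightarrow> 0 \<and> bdd_above (james_variations x)}" by simp
qed

setup_lifting type_definition_james

lemma james_var_L2: "james_var x n p = L2_set (\<lambda>i. x (p i) - x (p (i - 1))) {1..n}"
  by (simp add: james_var_def L2_set_def)

lemma james_variations_nonempty: "james_variations x \<noteq> {}"
proof -
  have "strict_mono_on {0..0::nat} (\<lambda>i::nat. i)" by (rule strict_mono_onI) simp
  then show ?thesis unfolding james_variations_def by blast
qed

lemma james_bddI:
  assumes "\<And>n p. strict_mono_on {0..n} p \<Longrightarrow> james_var x n p \<le> b"
  shows "bdd_above (james_variations x)"
  using assms by (auto simp: james_variations_def intro!: bdd_aboveI[of _ b])

lemma james_var_le_Sup:
  "bdd_above (james_variations x) \<Longrightarrow> strict_mono_on {0..n} p \<Longrightarrow> james_var x n p \<le> Sup (james_variations x)"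
  by (rule cSup_upper) (auto simp: james_variations_def)

lemma james_Sup_le:
  assumes "\<And>n p. strict_mono_on {0..n} p \<Longrightarrow> james_var x n p \<le> b"
  shows "Sup (james_variations x) \<le> b"
  using assms by (intro cSup_least james_variations_nonempty) (auto simp: james_variations_def)

lemma james_var_add: "james_var (\<lambda>k. x k + y k) n p \<le> james_var x n p + james_var y n p"
  using L2_set_triangle_ineq[of "\<lambda>i. x (p i) - x (p (i - 1))" "\<lambda>i. y (p i) - y (p (i - 1))" "{1..n}"]
  by (simp add: james_var_L2 algebra_simps)

lemma james_var_scale: "james_var (\<lambda>k. r * x k) n p = \<bar>r\<bar> * james_var x n p"
proof -
  have "\<bar>r\<bar> * james_var x n p = L2_set (\<lambda>i. \<bar>r\<bar> * (x (p i) - x (p (i - 1)))) {1..n}"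
    unfolding james_var_L2 by (rule L2_set_right_distrib) simp
  also have "\<dots> = james_var (\<lambda>k. r * x k) n p"
    by (simp add: james_var_def L2_set_def power_mult_distrib flip: right_diff_distrib)
  finally show ?thesis by simp
qed

lemma james_bdd_add:
  assumes "bdd_above (james_variations x)" "bdd_above (james_variations y)"
  shows "bdd_above (james_variations (\<lambda>k. x k + y k))"
  by (rule james_bddI[of _ "Sup (james_variations x) + Sup (james_variations y)"])
    (rule order_trans[OF james_var_add add_mono], simp_all add: james_var_le_Sup assms)

lemma james_bdd_scale:
  assumes "bdd_above (james_variations x)"
  shows "bdd_above (james_variations (\<lambda>k. r * x k))"
  by (rule james_bddI[of _ "\<bar>r\<bar> * Sup (james_variations x)"])
    (simp add: james_var_scale james_var_le_Sup assms mult_left_mono)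

lemma abs_le_james_Sup:
  assumes "x \<longlonglongrightarrow> 0" "bdd_above (james_variations x)"
  shows "\<bar>x k\<bar> \<le> Sup (james_variations x)"
proof -
  have "\<bar>x m - x k\<bar> \<le> Sup (james_variations x)" if "k < m" for m
  proof -
    have "strict_mono_on {0..1::nat} (\<lambda>i::nat. if i = 0 then k else m)"
      using that by (auto simp: strict_mono_on_def)
    from james_var_le_Sup[OF assms(2) this] show ?thesis by (simp add: james_var_def)
  qed
  then have "\<forall>\<^sub>F m in sequentially. \<bar>x m - x k\<bar> \<le> Sup (james_variations x)"
    unfolding eventually_sequentially by (metis Suc_le_lessD)
  moreover have "(\<lambda>m. \<bar>x m - x k\<bar>) \<longlonglongrightarrow> \<bar>0 - x k\<bar>"
    by (intro tendsto_intros assms)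
  ultimately show ?thesis
    using tendsto_upperbound[of "\<lambda>m. \<bar>x m - x k\<bar>" "\<bar>0 - x k\<bar>" sequentially] by simp
qed

instantiation james :: real_normed_vector
begin

lift_definition zero_james :: james is "\<lambda>_. 0"
  using james_bddI[of "\<lambda>_. 0" 0] by (simp add: james_var_def)
lift_definition plus_james :: "james \<Rightarrow> james \<Rightarrow> james" is "\<lambda>x y n. x n + y n"
  by (simp add: tendsto_add_zero james_bdd_add)
lift_definition minus_james :: "james \<Rightarrow> james \<Rightarrow> james" is "\<lambda>x y n. x n - y n"
proof -
  fix x y :: "nat \<Rightarrow> real"
  assume x: "x \<longlonglongrightarrow> 0 \<and> bdd_above (james_variations x)"
    and y: "y \<longlonglongrightarrow> 0 \<and> bdd_above (james_variations y)"
  show "(\<lambda>n. x n - y n) \<longlonglongrightarrow> 0 \<and> bdd_above (james_variations (\<lambda>n. x n - y n))"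
    using tendsto_diff[of x 0 sequentially y 0] james_bdd_add[of x "\<lambda>n. - 1 * y n"]
      james_bdd_scale[of y "- 1"] x y by simp
qed
lift_definition uminus_james :: "james \<Rightarrow> james" is "\<lambda>x n. - x n"
proof -
  fix x :: "nat \<Rightarrow> real"
  assume x: "x \<longlonglongrightarrow> 0 \<and> bdd_above (james_variations x)"
  show "(\<lambda>n. - x n) \<longlonglongrightarrow> 0 \<and> bdd_above (james_variations (\<lambda>n. - x n))"
    using tendsto_minus[of x 0] james_bdd_scale[of x "- 1"] x by simp
qed
lift_definition scaleR_james :: "real \<Rightarrow> james \<Rightarrow> james" is "\<lambda>r x n. r * x n"
  by (simp add: tendsto_mult_right_zero james_bdd_scale)
lift_definition norm_james :: "james \<Rightarrow> real" is "\<lambda>x. Sup (james_variations x)" .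

definition dist_james :: "james \<Rightarrow> james \<Rightarrow> real" where "dist_james x y = norm (x - y)"
definition sgn_james :: "james \<Rightarrow> james" where "sgn_james x = inverse (norm x) *\<^sub>R x"
definition uniformity_james :: "(james \<times> james) filter" where
  "uniformity_james = (INF e\<in>{0<..}. principal {(x, y). dist x y < e})"
definition open_james :: "james set \<Rightarrow> bool" where
  "open_james U \<longleftrightarrow> (\<forall>x\<in>U. \<forall>\<^sub>F (x', y) in uniformity. x' = x \<longrightarrow> y \<in> U)"

instance
proof
  fix x y z :: james and r s :: real
  show "x + y + z = x + (y + z)" by transfer (simp add: add.assoc)
  show "x + y = y + x" by transfer (simp add: add.commute)
  show "0 + x = x" by transfer simp
  show "- x + x = 0" by transfer simp
  show "x - y = x + - y" by transfer simp
  show "r *\<^sub>R (x + y) = r *\<^sub>R x + r *\<^sub>R y" by transfer (simp add: distrib_left)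
  show "(r + s) *\<^sub>R x = r *\<^sub>R x + s *\<^sub>R x" by transfer (simp add: distrib_right)
  show "r *\<^sub>R s *\<^sub>R x = (r * s) *\<^sub>R x" by transfer (simp add: mult.assoc)
  show "1 *\<^sub>R x = x" by transfer simp
  show "dist x y = norm (x - y)" by (rule dist_james_def)
  show "sgn x = inverse (norm x) *\<^sub>R x" by (rule sgn_james_def)
  show "uniformity = (INF e\<in>{0<..}. principal {(x, y :: james). dist x y < e})"
    by (rule uniformity_james_def)
  show "open U \<longleftrightarrow> (\<forall>x\<in>U. \<forall>\<^sub>F (x', y) in uniformity. x' = x \<longrightarrow> y \<in> U)" for U :: "james set"
    by (rule open_james_def)
  show "norm x = 0 \<longleftrightarrow> x = 0"
  proof transfer
    fix x :: "nat \<Rightarrow> real" assume x: "x \<longlonglongrightarrow> 0 \<and> bdd_above (james_variations x)"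
    show "Sup (james_variations x) = 0 \<longleftrightarrow> x = (\<lambda>_. 0)"
    proof
      assume "Sup (james_variations x) = 0"
      then show "x = (\<lambda>_. 0)" using abs_le_james_Sup[of x] x by auto
    next
      assume x0: "x = (\<lambda>_. 0)"
      then have "Sup (james_variations x) \<le> 0" by (intro james_Sup_le) (simp add: james_var_def)
      then show "Sup (james_variations x) = 0" using abs_le_james_Sup[of x 0] x x0 by simp
    qed
  qed
  show "norm (x + y) \<le> norm x + norm y"
  proof transfer
    fix x y :: "nat \<Rightarrow> real"
    assume x: "x \<longlonglongrightarrow> 0 \<and> bdd_above (james_variations x)"
      and y: "y \<longlonglongrightarrow> 0 \<and> bdd_above (james_variations y)"
    show "Sup (james_variations (\<lambda>n. x n + y n)) \<le> Sup (james_variations x) + Sup (james_variations y)"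
    proof (rule james_Sup_le)
      fix n p assume "strict_mono_on {0..n} (p :: nat \<Rightarrow> nat)"
      then have "james_var x n p \<le> Sup (james_variations x)" "james_var y n p \<le> Sup (james_variations y)"
        using x y by (simp_all add: james_var_le_Sup)
      then show "james_var (\<lambda>n. x n + y n) n p \<le> Sup (james_variations x) + Sup (james_variations y)"
        using james_var_add[of x y n p] by linarith
    qed
  qed
  have le: "norm (r *\<^sub>R x) \<le> \<bar>r\<bar> * norm x" for r and x :: james
  proof transfer
    fix r and x :: "nat \<Rightarrow> real" assume "x \<longlonglongrightarrow> 0 \<and> bdd_above (james_variations x)"
    then show "Sup (james_variations (\<lambda>n. r * x n)) \<le> \<bar>r\<bar> * Sup (james_variations x)"
      by (intro james_Sup_le) (simp add: james_var_scale james_var_le_Sup mult_left_mono)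
  qed
  show "norm (r *\<^sub>R x) = \<bar>r\<bar> * norm x"
  proof (cases "r = 0")
    case True
    have nonneg: "0 \<le> norm x" for x :: james
    proof transfer
      fix x :: "nat \<Rightarrow> real" assume "x \<longlonglongrightarrow> 0 \<and> bdd_above (james_variations x)"
      then show "0 \<le> Sup (james_variations x)"
        using abs_le_james_Sup[of x 0] by simp
    qed
    show ?thesis using le[of r x] nonneg[of "r *\<^sub>R x"] True by simp
  next
    case False
    have "inverse r *\<^sub>R r *\<^sub>R x = x" using False by transfer (simp add: fun_eq_iff)
    then have "norm x \<le> inverse \<bar>r\<bar> * norm (r *\<^sub>R x)"
      using le[of "inverse r" "r *\<^sub>R x"] by (simp add: abs_inverse)
    then have "\<bar>r\<bar> * norm x \<le> norm (r *\<^sub>R x)"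
      using False by (simp add: field_simps)
    then show ?thesis using le[of r x] by simp
  qed
qed

end

lemma james_coord_tendsto: "james_coord x \<longlonglongrightarrow> 0"
  and james_coord_bdd: "bdd_above (james_variations (james_coord x))"
  using james_coord[of x] by simp_all

lemma abs_james_coord_le: "\<bar>james_coord x k\<bar> \<le> norm x"
  unfolding norm_james.rep_eq by (intro abs_le_james_Sup james_coord_tendsto james_coord_bdd)

instance james :: banach
proof
  fix X :: "nat \<Rightarrow> james" assume X: "Cauchy X"
  have le: "\<bar>james_coord (X m) k - james_coord (X n) k\<bar> \<le> norm (X m - X n)" for m n k
    using abs_james_coord_le[of "X m - X n" k] by (simp add: minus_james.rep_eq)
  have "Cauchy (\<lambda>n. james_coord (X n) k)" for k
    unfolding Cauchy_iff
  proof (intro allI impI)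
    fix e :: real assume "0 < e"
    then obtain M where M: "\<forall>m\<ge>M. \<forall>n\<ge>M. norm (X m - X n) < e"
      using X unfolding Cauchy_iff by blast
    show "\<exists>M. \<forall>m\<ge>M. \<forall>n\<ge>M. norm (james_coord (X m) k - james_coord (X n) k) < e"
    proof (intro exI[of _ M] allI impI)
      fix m n assume "M \<le> m" "M \<le> n"
      then have "norm (X m - X n) < e" using M by blast
      then show "norm (james_coord (X m) k - james_coord (X n) k) < e" using le[of m k n] by simp
    qed
  qed
  then have conv: "(\<lambda>n. james_coord (X n) k) \<longlonglongrightarrow> lim (\<lambda>n. james_coord (X n) k)" for k
    by (simp add: Cauchy_convergent_iff convergent_LIMSEQ_iff)
  define y where "y k = lim (\<lambda>n. james_coord (X n) k)" for k
  have unif: "\<exists>N. \<forall>m\<ge>N. \<forall>n p. strict_mono_on {0..n} p \<longrightarrow>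
      james_var (\<lambda>k. james_coord (X m) k - y k) n p \<le> e" if "0 < e" for e
  proof -
    obtain N where N: "\<And>m n. m \<ge> N \<Longrightarrow> n \<ge> N \<Longrightarrow> norm (X m - X n) < e"
      using X \<open>0 < e\<close> unfolding Cauchy_iff by blast
    have "james_var (\<lambda>k. james_coord (X m) k - y k) n p \<le> e"
      if "m \<ge> N" and p: "strict_mono_on {0..n} p" for m n p
    proof (rule tendsto_upperbound)
      show "(\<lambda>l. james_var (\<lambda>k. james_coord (X m) k - james_coord (X l) k) n p)
          \<longlonglongrightarrow> james_var (\<lambda>k. james_coord (X m) k - y k) n p"
        unfolding y_def james_var_def by (intro tendsto_intros conv)
      have "james_var (\<lambda>k. james_coord (X m) k - james_coord (X l) k) n p \<le> e" if "l \<ge> N" for l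
        using N[OF \<open>m \<ge> N\<close> that] james_var_le_Sup[OF james_coord_bdd p, of "X m - X l"]
        by (simp add: norm_james.rep_eq minus_james.rep_eq)
      then show "\<forall>\<^sub>F l in sequentially. james_var (\<lambda>k. james_coord (X m) k - james_coord (X l) k) n p \<le> e"
        unfolding eventually_sequentially by blast
    qed simp
    then show ?thesis by blast
  qed
  have unif_coord: "\<exists>N. \<forall>n\<ge>N. \<forall>k. \<bar>james_coord (X n) k - y k\<bar> \<le> e" if "0 < e" for e
  proof -
    obtain N where N: "\<And>m n. m \<ge> N \<Longrightarrow> n \<ge> N \<Longrightarrow> norm (X m - X n) < e"
      using X \<open>0 < e\<close> unfolding Cauchy_iff by blast
    have "\<bar>james_coord (X n) k - y k\<bar> \<le> e" if "n \<ge> N" for n k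
    proof (rule tendsto_upperbound)
      show "(\<lambda>m. \<bar>james_coord (X n) k - james_coord (X m) k\<bar>) \<longlonglongrightarrow> \<bar>james_coord (X n) k - y k\<bar>"
        unfolding y_def by (intro tendsto_intros conv)
      have "\<bar>james_coord (X n) k - james_coord (X m) k\<bar> \<le> e" if "m \<ge> N" for m
        using N[OF \<open>n \<ge> N\<close> that] le[of n k m] by linarith
      then show "\<forall>\<^sub>F m in sequentially. \<bar>james_coord (X n) k - james_coord (X m) k\<bar> \<le> e"
        unfolding eventually_sequentially by blast
    qed simp
    then show ?thesis by blast
  qed
  have y0: "y \<longlonglongrightarrow> 0"
    unfolding LIMSEQ_iff
  proof (intro allI impI)
    fix e :: real assume "0 < e"
    then obtain N where N: "\<And>k. \<bar>james_coord (X N) k - y k\<bar> \<le> e / 2"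
      using unif_coord[of "e / 2"] by auto
    obtain K where K: "\<And>k. k \<ge> K \<Longrightarrow> norm (james_coord (X N) k) < e / 2"
      using LIMSEQ_D[OF james_coord_tendsto[of "X N"], of "e / 2"] \<open>0 < e\<close> by auto
    have "norm (y k - 0) < e" if "k \<ge> K" for k
      using N[of k] K[OF that] unfolding real_norm_def by linarith
    then show "\<exists>K. \<forall>k\<ge>K. norm (y k - 0) < e" by blast
  qed
  obtain N where N: "\<And>n p. strict_mono_on {0..n} p \<Longrightarrow> james_var (\<lambda>k. james_coord (X N) k - y k) n p \<le> 1"
    using unif[of 1] by auto
  have "bdd_above (james_variations (\<lambda>k. james_coord (X N) k - y k))"
    using N by (rule james_bddI)
  note james_bdd_add[OF james_coord_bdd[of "X N"] james_bdd_scale[OF this, of "- 1"]]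
  then have "bdd_above (james_variations y)" by simp
  with y0 have y: "james_coord (Abs_james y) = y" by (simp add: Abs_james_inverse)
  have "X \<longlonglongrightarrow> Abs_james y"
    unfolding LIMSEQ_iff
  proof (intro allI impI)
    fix e :: real assume "0 < e"
    then obtain N where N: "\<And>m n p. m \<ge> N \<Longrightarrow> strict_mono_on {0..n} p \<Longrightarrow>
        james_var (\<lambda>k. james_coord (X m) k - y k) n p \<le> e / 2"
      using unif[of "e / 2"] by auto
    have "norm (X m - Abs_james y) < e" if "m \<ge> N" for m
    proof -
      have "norm (X m - Abs_james y) \<le> e / 2"
        unfolding norm_james.rep_eq
        by (rule james_Sup_le) (unfold minus_james.rep_eq y, rule N[OF that])
      then show ?thesis using \<open>0 < e\<close> by simp
    qed
    then show "\<exists>N. \<forall>n\<ge>N. norm (X n - Abs_james y) < e" by blast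
  qed
  then show "convergent X" by (rule convergentI)
qed

global_interpretation james: banach_space_over "(*\<^sub>R) :: real \<Rightarrow> james \<Rightarrow> james"
  by unfold_locales (simp_all add: scaleR_add_right scaleR_add_left)

lift_definition james_unit_vector :: "nat \<Rightarrow> james" is "\<lambda>n k. if k = n then 1 else 0"
proof
  fix m :: nat
  show "(\<lambda>k. if k = m then 1 else (0::real)) \<longlonglongrightarrow> 0"
    by (rule tendsto_eventually) (auto simp: eventually_sequentially intro!: exI[of _ "Suc m"])
  let ?x = "\<lambda>k. if k = m then 1 else (0::real)"
  show "bdd_above (james_variations ?x)"
  proof (rule james_bddI[of _ 2])
    fix n p assume p: "strict_mono_on {0..n} (p :: nat \<Rightarrow> nat)"
    have inj: "inj_on p {0..n}" using p by (rule strict_mono_on_imp_inj_on)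
    have one: "(\<Sum>i\<in>S. ?x (q i)) \<le> 1" if "inj_on q S" "finite S" for q :: "nat \<Rightarrow> nat" and S
    proof -
      have "(\<Sum>i\<in>S. ?x (q i)) = (\<Sum>k\<in>q ` S. ?x k)"
        by (simp only: sum.reindex[OF that(1)] o_def)
      also have "\<dots> \<le> 1" using that(2) by (subst sum.delta) auto
      finally show ?thesis .
    qed
    have "inj_on (\<lambda>i. p (i - 1)) {1..n}"
    proof (rule inj_onI)
      fix i j assume ij: "i \<in> {1..n}" "j \<in> {1..n}" "p (i - 1) = p (j - 1)"
      then have "i - 1 = j - 1" using inj by (auto simp: inj_on_def)
      then show "i = j" using ij by auto
    qed
    then have s2: "(\<Sum>i\<in>{1..n}. ?x (p (i - 1))) \<le> 1" by (intro one) auto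
    have s1: "(\<Sum>i\<in>{1..n}. ?x (p i)) \<le> 1"
      by (intro one inj_on_subset[OF inj]) auto
    have "james_var ?x n p \<le> (\<Sum>i\<in>{1..n}. \<bar>?x (p i) - ?x (p (i - 1))\<bar>)"
      unfolding james_var_L2 by (rule L2_set_le_sum_abs)
    also have "\<dots> \<le> (\<Sum>i\<in>{1..n}. ?x (p i) + ?x (p (i - 1)))"
      by (rule sum_mono) auto
    also have "\<dots> \<le> 2" using s1 s2 unfolding sum.distrib by linarith
    finally show "james_var ?x n p \<le> 2" .
  qed
qed

definition james_unit :: "nat \<Rightarrow> james \<times> (james \<Rightarrow> real)" where
  "james_unit n = (james_unit_vector n, \<lambda>x. james_coord x n)"

lemma james_unit_biorthogonal: "james.biorthogonal james_unit"
  by (simp add: james.biorthogonal_def james_unit_def james_unit_vector.rep_eq)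

lemma james_unit_dual: "range james_unit \<subseteq> UNIV \<times> james.continuous_dual"
proof -
  have "Vector_Spaces.linear (*\<^sub>R) (*) (\<lambda>x. james_coord x n)" for n
    by unfold_locales
      (simp_all add: algebra_simps plus_james.rep_eq scaleR_james.rep_eq)
  moreover have "continuous_on UNIV (\<lambda>x. james_coord x n)" for n
  proof -
    have "bounded_linear (\<lambda>x. james_coord x n)"
      by (rule bounded_linear_intro[where K = 1])
        (simp_all add: plus_james.rep_eq scaleR_james.rep_eq abs_james_coord_le)
    then show ?thesis by (rule linear_continuous_on)
  qed
  ultimately show ?thesis by (auto simp: james.continuous_dual_def james_unit_def)
qed

end

theory Submission
  imports Defs
begin

text \<open>
  If \<open>a\<close> is simple over a basis \<open>u\<close> via \<open>D\<close>, \<open>h\<close> and \<open>b\<close>, then up to finite sets the failure of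
  convergence at \<open>x\<close> is measured by the sets of those \<open>n\<close> in \<open>D\<close> at which the coordinate of \<open>x\<close>
  of index \<open>h n\<close> times the norm of \<open>b (h n)\<close> is at least \<open>\<epsilon>\<close>. Both spaces consist of null sequences
  and contain all decreasing ones, which suffice to produce every set on which the norm of
  \<open>b (h n)\<close> tends to infinity. So, unless \<open>h\<close> has an infinite, hence cofinite, fibre and the critical
  ideal is trivial, that ideal consists of the sets meeting every fibre of some \<open>v : \<nat> \<rightarrow> \<nat>\<close> in
  a finite set. According as infinitely many fibres of \<open>v\<close> are infinite or, if not, the union of the
  infinite ones is cofinite or not, this is one of the three ideals.

  Conversely, given \<open>v\<close>, let \<open>a (n + 1) = u (n + 1) + c n \<cdot> a n\<close> with \<open>n\<close>-th functional
  \<open>u* n - c n \<cdot> u* (n + 1)\<close>. The partial sums telescope: their difference at \<open>n\<close> is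
  \<open>u* (n + 1) \<cdot> c n \<cdot> a n\<close>, so taking \<open>c n\<close> to be \<open>v n + 1\<close> divided by the norm of \<open>a n\<close>
  prescribes the norms at will.
\<close>

section \<open>Ideals of sets with finite fibres\<close>

lemma ideal_on_finite: "ideal_on M I \<Longrightarrow> finite A \<Longrightarrow> A \<subseteq> M \<Longrightarrow> A \<in> I"
  by (simp add: ideal_on_def)

lemma ideal_on_subset:
  assumes "ideal_on M I" "A \<in> I" "B \<subseteq> A"
  shows "B \<in> I"
  using assms unfolding ideal_on_def by metis

lemma ideal_on_Un: "ideal_on M I \<Longrightarrow> A \<in> I \<Longrightarrow> B \<in> I \<Longrightarrow> A \<union> B \<in> I"
  by (simp add: ideal_on_def)

text \<open>A normal form for all three ideals: \<open>v\<close> constant gives Fin; one infinite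
  fibre with infinite complement and all other fibres finite gives the sum with the power set;
  infinitely many infinite fibres give the product.\<close>

definition fibre_ideal :: "(nat \<Rightarrow> nat) \<Rightarrow> nat set set" where
  "fibre_ideal v = {A. \<forall>j. finite {n \<in> A. v n = j}}"

lemma ideal_on_fibre_ideal: "ideal_on UNIV (fibre_ideal v)"
proof -
  have un: "{n. (n \<in> A \<or> n \<in> B) \<and> v n = j} = {n \<in> A. v n = j} \<union> {n \<in> B. v n = j}" for A B j
    by blast
  have "finite {n \<in> B. v n = j}" if "finite {n \<in> A. v n = j}" "B \<subseteq> A" for A B j
    by (rule finite_subset[OF _ that(1)]) (use that(2) in blast)
  then show ?thesis
    unfolding ideal_on_def fibre_ideal_def by (simp add: un) blast
qed

lemma finite_fibres_le:
  assumes "A \<in> fibre_ideal v"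
  shows "finite {n \<in> A. v n \<le> j}"
proof -
  have "{n \<in> A. v n \<le> j} = (\<Union>i\<in>{..j}. {n \<in> A. v n = i})" by auto
  then show ?thesis using assms by (simp add: fibre_ideal_def)
qed

section \<open>Isomorphism types of fibre ideals\<close>

lemma ideal_isomorphic_imp_fibre_ideal:
  fixes w :: "'n \<Rightarrow> nat"
  assumes iso: "ideal_isomorphic UNIV I N J"
    and J: "J = {A. A \<subseteq> N \<and> (\<forall>j. finite {p \<in> A. w p = j})}"
  shows "\<exists>v. I = fibre_ideal v"
proof -
  obtain f where f: "bij_betw f N UNIV" and fI: "\<And>A. f -` A \<inter> N \<in> J \<longleftrightarrow> A \<in> I"
    using iso unfolding ideal_isomorphic_def by auto
  \<comment> \<open>The witness is \<open>w \<circ> g\<close>: its fibres within \<open>A\<close>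
    are the images under \<open>f\<close> of the fibres of \<open>w\<close> within the preimage of
    \<open>A\<close>, and \<open>f\<close> is injective.\<close>
  define g where "g = inv_into N f"
  have gf: "g (f p) = p" if "p \<in> N" for p
    using f that by (simp add: g_def bij_betw_def)
  have "{n \<in> A. w (g n) = j} = f ` {p \<in> f -` A \<inter> N. w p = j}" for A j
    using gf f by (force simp: bij_betw_def image_iff)
  moreover have "inj_on f {p \<in> f -` A \<inter> N. w p = j}" for A j
    using f by (auto simp: bij_betw_def inj_on_def)
  ultimately have "finite {n \<in> A. w (g n) = j} \<longleftrightarrow> finite {p \<in> f -` A \<inter> N. w p = j}" for A j
    by (simp add: finite_image_iff)
  then have "f -` A \<inter> N \<in> J \<longleftrightarrow> A \<in> fibre_ideal (w \<circ> g)" for A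
    by (simp add: J fibre_ideal_def)
  then have "I = fibre_ideal (w \<circ> g)"
    using fI by blast
  then show ?thesis by blast
qed

lemma enumerate_bij_betw:
  "infinite S \<Longrightarrow> bij_betw (enumerate S) UNIV (S :: nat set)"
  by (simp add: bij_betw_def range_enumerate strict_mono_enumerate strict_mono_imp_inj_on)

text \<open>Column \<open>i\<close> is laid onto the fibre over the \<open>i\<close>-th element of
  \<open>J\<close>, in increasing order; this is a bijection because every fibre over
  \<open>J\<close> is infinite and the fibres partition the naturals.\<close>

lemma fibre_ideal_isomorphic_empty_otimes_Fin:
  assumes J: "infinite J" and range: "range v \<subseteq> J" and fib: "\<And>j. j \<in> J \<Longrightarrow> infinite (v -` {j})"
  shows "ideal_isomorphic UNIV (fibre_ideal v) UNIV empty_otimes_Fin"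
proof -
  define f where "f = (\<lambda>(i, k). enumerate (v -` {enumerate J i}) k)"
  note eJ = enumerate_bij_betw[OF J]
  have inf: "infinite (v -` {enumerate J i})" for i
    by (rule fib) (rule enumerate_in_set[OF J])
  note eF = enumerate_bij_betw[OF inf]
  have vf: "v (f (i, k)) = enumerate J i" for i k
    using enumerate_in_set[OF inf, of i k] by (simp add: f_def)
  have "bij f"
  proof (rule bijI)
    show "inj f"
    proof (rule injI, clarify)
      fix i k i' k' assume eq: "f (i, k) = f (i', k')"
      then have "enumerate J i = enumerate J i'" using vf by metis
      then have i: "i = i'" using eJ by (simp add: bij_betw_def inj_eq)
      then show "i = i' \<and> k = k'" using eq eF[of i] by (simp add: f_def bij_betw_def inj_eq)
    qed
    have "n \<in> range f" for n
    proof -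
      obtain i where i: "v n = enumerate J i"
        using eJ range unfolding bij_betw_def by (metis imageE range_subsetD)
      then obtain k where "n = enumerate (v -` {enumerate J i}) k"
        using eF[of i] unfolding bij_betw_def by (metis imageE vimage_singleton_eq)
      then have "n = f (i, k)" by (simp add: f_def)
      then show ?thesis by blast
    qed
    then show "surj f" by blast
  qed
  moreover have "f -` A \<in> empty_otimes_Fin \<longleftrightarrow> A \<in> fibre_ideal v" for A
  proof -
    have img: "{n \<in> A. v n = enumerate J i} = enumerate (v -` {enumerate J i}) ` {k. f (i, k) \<in> A}"
      (is "_ = ?e ` _") for i
    proof -
      have "n \<in> ?e ` {k. f (i, k) \<in> A}" if "n \<in> A" "v n = enumerate J i" for n
      proof -
        have "n \<in> range ?e" using eF[of i] that(2) by (simp add: bij_betw_def)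
        then obtain k where "n = ?e k" ..
        moreover from this have "f (i, k) \<in> A" using that(1) by (simp add: f_def)
        ultimately show ?thesis by (rule image_eqI[OF _ CollectI])
      qed
      moreover have "?e k \<in> A \<and> v (?e k) = enumerate J i" if "f (i, k) \<in> A" for k
        using that vf[of i k] by (simp add: f_def)
      ultimately show ?thesis by blast
    qed
    have "finite {n \<in> A. v n = enumerate J i} \<longleftrightarrow> finite {k. f (i, k) \<in> A}" for i
      unfolding img using eF[of i]
      by (intro finite_image_iff) (auto simp: bij_betw_def inj_on_def)
    moreover have "(\<forall>j. finite {n \<in> A. v n = j}) \<longleftrightarrow> (\<forall>i. finite {n \<in> A. v n = enumerate J i})"
    proof
      assume fin: "\<forall>i. finite {n \<in> A. v n = enumerate J i}"
      show "\<forall>j. finite {n \<in> A. v n = j}"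
      proof
        fix j
        show "finite {n \<in> A. v n = j}"
        proof (cases "j \<in> J")
          case True
          then obtain i where "j = enumerate J i" using eJ unfolding bij_betw_def by blast
          then show ?thesis using fin by simp
        next
          case False
          then have "{n \<in> A. v n = j} = {}" using range by blast
          then show ?thesis by (simp only: finite.emptyI)
        qed
      qed
    qed blast
    ultimately show ?thesis by (simp add: empty_otimes_Fin_def fibre_ideal_def)
  qed
  ultimately show ?thesis unfolding ideal_isomorphic_def by auto
qed

lemma ideal_isomorphic_Fin_oplus_Pow:
  assumes "infinite B" "infinite (- B)"
  shows "ideal_isomorphic UNIV {A :: nat set. finite (A \<inter> B)} ({0, 1} \<times> UNIV) Fin_oplus_Pow"
proof -
  note e = enumerate_bij_betw[OF assms(1)] enumerate_bij_betw[OF assms(2)]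
  define f where "f = (\<lambda>(i :: nat, k). if i = 0 then enumerate B k else enumerate (- B) k)"
  have "bij_betw f ({0} \<times> UNIV) B"
    using e(1) by (force simp: f_def bij_betw_def inj_on_def image_iff)
  moreover have "bij_betw f ({1} \<times> UNIV) (- B)"
    using e(2) by (force simp: f_def bij_betw_def inj_on_def image_iff)
  ultimately have "bij_betw f ({0} \<times> UNIV \<union> {1} \<times> UNIV) (B \<union> - B)"
    by (rule bij_betw_combine) simp
  moreover have "{0} \<times> UNIV \<union> {1} \<times> UNIV = {0, 1 :: nat} \<times> (UNIV :: nat set)" by blast
  ultimately have "bij_betw f ({0, 1} \<times> UNIV) UNIV" by simp
  moreover have "f -` A \<inter> {0, 1} \<times> UNIV \<in> Fin_oplus_Pow \<longleftrightarrow> finite (A \<inter> B)" for A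
  proof -
    have B: "B = range (enumerate B)" using e(1) by (simp add: bij_betw_def)
    have "A \<inter> B = f ` (f -` A \<inter> {0, 1} \<times> UNIV \<inter> {0} \<times> UNIV)"
      by (subst B) (force simp: f_def image_iff)
    moreover have "inj_on f (f -` A \<inter> {0, 1} \<times> UNIV \<inter> {0} \<times> UNIV)"
      using e(1) by (auto simp: f_def bij_betw_def inj_on_def)
    ultimately have "finite (A \<inter> B) \<longleftrightarrow> finite (f -` A \<inter> {0, 1} \<times> UNIV \<inter> {0} \<times> UNIV)"
      by (simp add: finite_image_iff)
    then show ?thesis by (simp add: Fin_oplus_Pow_def)
  qed
  ultimately show ?thesis unfolding ideal_isomorphic_def by blast
qed

text \<open>Only infinite fibres impose a condition on \<open>A\<close>. Finitely many of them
  impose the single condition that \<open>A\<close> meet their union \<open>B\<close> in a finite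
  set, and the type depends on whether \<open>B\<close> is cofinite. If there are infinitely many,
  the finite fibres can be absorbed into them.\<close>

lemma fibre_ideal_cases:
  assumes nontriv: "fibre_ideal v \<noteq> Pow UNIV"
  shows "ideal_isomorphic UNIV (fibre_ideal v) UNIV Fin_ideal
    \<or> ideal_isomorphic UNIV (fibre_ideal v) ({0, 1} \<times> UNIV) Fin_oplus_Pow
    \<or> ideal_isomorphic UNIV (fibre_ideal v) UNIV empty_otimes_Fin"
proof -
  define J where "J = {j. infinite (v -` {j})}"
  have fin: "finite {n \<in> A. v n = j}" if "j \<notin> J" for A j
    by (rule finite_subset[of _ "v -` {j}"]) (use that in \<open>auto simp: J_def\<close>)
  show ?thesis
  proof (cases "finite J")
    case True
    define B where "B = v -` J"
    have eq: "fibre_ideal v = {A. finite (A \<inter> B)}"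
    proof -
      have "(\<forall>j. finite {n \<in> A. v n = j}) \<longleftrightarrow> finite (A \<inter> B)" for A
      proof
        assume "\<forall>j. finite {n \<in> A. v n = j}"
        moreover have "A \<inter> B = (\<Union>j\<in>J. {n \<in> A. v n = j})" by (auto simp: B_def)
        ultimately show "finite (A \<inter> B)" using True by simp
      next
        assume AB: "finite (A \<inter> B)"
        show "\<forall>j. finite {n \<in> A. v n = j}"
        proof
          fix j show "finite {n \<in> A. v n = j}"
          proof (cases "j \<in> J")
            case True
            then show ?thesis by (intro finite_subset[OF _ AB]) (auto simp: B_def)
          qed (rule fin)
        qed
      qed
      then show ?thesis by (simp add: fibre_ideal_def)
    qed
    \<comment> \<open>Nontriviality enters here: for finite \<open>B\<close> every set would belong
      to the ideal.\<close>
    have B: "infinite B"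
    proof
      assume "finite B"
      then have "fibre_ideal v = Pow UNIV" by (simp add: eq)
      then show False using nontriv by contradiction
    qed
    show ?thesis
    proof (cases "finite (- B)")
      case True
      have "finite (A \<inter> B) \<longleftrightarrow> finite A" for A
        using finite_subset[of A "A \<inter> B \<union> - B"] True by auto
      then have "fibre_ideal v = Fin_ideal" by (simp add: eq Fin_ideal_def)
      moreover have "ideal_isomorphic UNIV Fin_ideal UNIV Fin_ideal"
        unfolding ideal_isomorphic_def by (rule exI[of _ id]) simp
      ultimately show ?thesis by simp
    next
      case False
      then show ?thesis using ideal_isomorphic_Fin_oplus_Pow[OF B] by (simp add: eq)
    qed
  next
    case J: False
    \<comment> \<open>Each point lying in a finite fibre is moved into an infinite fibre of its own.\<close>
    define w where "w n = (if v n \<in> J then v n else enumerate J n)" for n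
    have wJ: "w n \<in> J" for n by (simp add: w_def enumerate_in_set[OF J])
    have "v -` {j} \<subseteq> w -` {j}" if "j \<in> J" for j using that by (auto simp: w_def)
    then have "infinite (w -` {j})" if "j \<in> J" for j
      using that finite_subset unfolding J_def by blast
    then have "ideal_isomorphic UNIV (fibre_ideal w) UNIV empty_otimes_Fin"
      using J wJ by (intro fibre_ideal_isomorphic_empty_otimes_Fin[of J]) auto
    moreover have "fibre_ideal w = fibre_ideal v"
    proof -
      have "finite {n \<in> A. w n = j} \<longleftrightarrow> finite {n \<in> A. v n = j}" for A j
      proof (cases "j \<in> J")
        case True
        \<comment> \<open>By injectivity at most one point is moved into the fibre over
          \<open>j\<close>, so the traces of the two fibres on \<open>A\<close> differ by at most
          one point.\<close>
        have "inj (enumerate J)"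
          using enumerate_bij_betw[OF J] by (simp add: bij_betw_def)
        then have "finite (enumerate J -` {j})" by (simp add: finite_vimageI)
        then have f1: "finite {n \<in> A. v n \<notin> J \<and> enumerate J n = j}"
          by (rule rev_finite_subset) auto
        have "{n \<in> A. w n = j} = {n \<in> A. v n = j} \<union> {n \<in> A. v n \<notin> J \<and> enumerate J n = j}"
          using True by (auto simp: w_def)
        then show ?thesis using f1 by simp
      next
        case False
        then have "{n \<in> A. w n = j} = {}" using wJ by blast
        then show ?thesis using fin[OF False] by (metis finite.emptyI)
      qed
      then show ?thesis by (simp add: fibre_ideal_def)
    qed
    ultimately show ?thesis by simp
  qed
qed

text \<open>For the direction from right to left, each model ideal is itself described by finite
  fibres of a function on its ground set, and such a description is transported along
  bijections.\<close>

lemma fibre_ideal_iff: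
  assumes "I \<noteq> Pow UNIV"
  shows "(\<exists>v. I = fibre_ideal v) \<longleftrightarrow>
    ideal_isomorphic UNIV I UNIV Fin_ideal
    \<or> ideal_isomorphic UNIV I ({0, 1} \<times> UNIV) Fin_oplus_Pow
    \<or> ideal_isomorphic UNIV I UNIV empty_otimes_Fin"
    (is "?L \<longleftrightarrow> ?F \<or> ?P \<or> ?E")
proof
  assume ?L
  then show "?F \<or> ?P \<or> ?E" using fibre_ideal_cases assms by blast
next
  have F: "Fin_ideal = {A. A \<subseteq> UNIV \<and> (\<forall>j. finite {p \<in> A. (0 :: nat) = j})}"
  proof -
    have "(\<forall>j. finite {p \<in> A. (0 :: nat) = j}) \<longleftrightarrow> finite A" for A :: "nat set"
    proof
      assume "\<forall>j. finite {p \<in> A. (0 :: nat) = j}"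
      then have "finite {p \<in> A. (0 :: nat) = 0}" ..
      then show "finite A" by simp
    qed simp
    then show ?thesis by (simp add: Fin_ideal_def)
  qed
  \<comment> \<open>Column 0 becomes one fibre and each point of column 1 a fibre by itself;
    \<open>Suc\<close> keeps the values on column 1 away from 0.\<close>
  have P: "Fin_oplus_Pow = {A. A \<subseteq> {0, 1} \<times> UNIV \<and>
      (\<forall>j. finite {p \<in> A. (if fst p = 0 then 0 else Suc (snd p)) = j})}" (is "_ = ?P'")
  proof -
    have "finite (A \<inter> {0} \<times> UNIV) \<longleftrightarrow>
        (\<forall>j. finite {p \<in> A. (if fst p = 0 then 0 else Suc (snd p)) = j})"
      if A: "A \<subseteq> {0, 1} \<times> UNIV" for A :: "(nat \<times> nat) set"
    proof
      assume fin: "finite (A \<inter> {0} \<times> UNIV)"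
      show "\<forall>j. finite {p \<in> A. (if fst p = 0 then 0 else Suc (snd p)) = j}"
      proof
        fix j
        \<comment> \<open>For positive \<open>j\<close>, \<open>(1, j - 1)\<close> is the only point
          with value \<open>j\<close>; for \<open>j = 0\<close> it is a harmless extra
          point.\<close>
        have "finite (A \<inter> {0} \<times> UNIV \<union> {(1, j - 1)})" using fin by simp
        then show "finite {p \<in> A. (if fst p = 0 then 0 else Suc (snd p)) = j}"
          by (rule rev_finite_subset) (use A in \<open>auto split: if_splits\<close>)
      qed
    next
      assume "\<forall>j. finite {p \<in> A. (if fst p = 0 then 0 else Suc (snd p)) = j}"
      then have "finite {p \<in> A. (if fst p = 0 then 0 else Suc (snd p)) = 0}" ..
      then show "finite (A \<inter> {0} \<times> UNIV)" by (rule rev_finite_subset) auto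
    qed
    then show ?thesis unfolding Fin_oplus_Pow_def by (intro Collect_cong conj_cong refl)
  qed
  have E: "empty_otimes_Fin = {A. A \<subseteq> UNIV \<and> (\<forall>j. finite {p \<in> A. fst p = j})}"
  proof -
    have eq: "{p \<in> A. fst p = j} = Pair j ` {k. (j, k) \<in> A}" for A :: "(nat \<times> nat) set" and j
      by (auto simp: image_iff)
    have "finite {p \<in> A. fst p = j} \<longleftrightarrow> finite {k. (j, k) \<in> A}"
      for A :: "(nat \<times> nat) set" and j
      unfolding eq by (rule finite_image_iff) (simp add: inj_on_def)
    then show ?thesis by (simp add: empty_otimes_Fin_def)
  qed
  assume "?F \<or> ?P \<or> ?E"
  then show ?L
    using ideal_isomorphic_imp_fibre_ideal[OF _ F] ideal_isomorphic_imp_fibre_ideal[OF _ P]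
      ideal_isomorphic_imp_fibre_ideal[OF _ E] by blast
qed

text \<open>A vector is prescribed through its coordinates, indexed by \<open>k = h n\<close> and
  not by \<open>n\<close>, so the growth of \<open>v\<close> along \<open>S\<close> must be bounded
  below by a monotone function of \<open>k\<close>. The least value of \<open>v\<close> on the tail
  \<open>h n \<ge> k\<close> does this: the tails are nonempty and shrink, and each leaves behind
  the finitely many points with small \<open>v\<close>.\<close>

lemma exists_slow_minorant:
  fixes h v :: "nat \<Rightarrow> nat"
  assumes S: "infinite S" and v: "\<And>j. finite {n \<in> S. v n \<le> j}" and h: "\<And>k. finite {n \<in> S. h n < k}"
  obtains m :: "nat \<Rightarrow> nat" where "mono m" "filterlim m at_top sequentially" "\<And>n. n \<in> S \<Longrightarrow> m (h n) \<le> v n"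
proof
  define m where "m k = (LEAST j. \<exists>n\<in>S. k \<le> h n \<and> v n = j)" for k
  have ne: "\<exists>j. \<exists>n\<in>S. k \<le> h n \<and> v n = j" for k
  proof -
    have "S \<noteq> {n \<in> S. h n < k}" using S h by metis
    then have "\<exists>n\<in>S. k \<le> h n" by (auto simp: not_less)
    then show ?thesis by blast
  qed
  have m: "\<exists>n\<in>S. k \<le> h n \<and> v n = m k" for k
    unfolding m_def by (rule LeastI_ex[OF ne])
  have le: "m k \<le> v n" if "n \<in> S" "k \<le> h n" for k n
    unfolding m_def by (rule Least_le) (use that in blast)
  show "mono m"
  proof (rule monoI)
    fix k l :: nat assume "k \<le> l"
    then show "m k \<le> m l" using m[of l] le by (metis order_trans)
  qed
  show "m (h n) \<le> v n" if "n \<in> S" for n using le that by blast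
  show "filterlim m at_top sequentially"
    unfolding filterlim_at_top eventually_sequentially
  proof
    fix j :: nat
    obtain K where K: "\<And>n. n \<in> S \<Longrightarrow> v n \<le> j \<Longrightarrow> h n < K"
      using finite_nat_set_iff_bounded[of "h ` {n \<in> S. v n \<le> j}"] v[of j] by auto
    have "j \<le> m k" if "k \<ge> K" for k
      using m[of k] K that by (metis leD le_trans nat_le_linear)
    then show "\<exists>K. \<forall>k\<ge>K. j \<le> m k" by blast
  qed
qed


section \<open>Critical ideals of simple sequences\<close>

context banach_space_over
begin

text \<open>What the two unit vector bases have in common. The last clause speaks of decreasing
  sequences because the James space does not contain all null sequences.\<close>

definition monotone_null_basis :: "(nat \<Rightarrow> 'a \<times> ('a \<Rightarrow> 'k)) \<Rightarrow> bool" where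
  "monotone_null_basis u \<longleftrightarrow> biorthogonal u \<and> range u \<subseteq> UNIV \<times> continuous_dual
     \<and> (\<forall>x. (\<lambda>n. partial_sum u n x) \<longlonglongrightarrow> x)
     \<and> (\<forall>x. (\<lambda>n. snd (u n) x) \<longlonglongrightarrow> 0)
     \<and> (\<forall>z. decseq z \<and> z \<longlonglongrightarrow> 0 \<longrightarrow> (\<exists>x. \<forall>n. snd (u n) x = of_real (z n)))"

section \<open>From simple sequences to fibre ideals\<close>

lemma critical_ideal_eqI: "is_critical_ideal a C \<Longrightarrow> critical_ideal a = C"
  unfolding critical_ideal_def by (rule the1_equality[OF ex1_critical_ideal])

lemma is_critical_ideal_critical_ideal: "is_critical_ideal a (critical_ideal a)"
  unfolding critical_ideal_def by (rule theI'[OF ex1_critical_ideal])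

text \<open>The error of the partial sums of \<open>u\<close> exceeds \<open>\<epsilon> / 2\<close>
  only on a finite set, which lies in every ideal; the triangle inequality does the rest in both
  directions.\<close>

lemma ideal_Schauder_basis_iff_diff:
  assumes u: "\<And>x. (\<lambda>n. partial_sum u n x) \<longlonglongrightarrow> x" and I: "ideal_on UNIV I"
  shows "ideal_Schauder_basis I a \<longleftrightarrow>
    (\<forall>x. \<forall>\<epsilon>>0. {n. norm (partial_sum u n x - partial_sum a n x) \<ge> \<epsilon>} \<in> I)"
proof -
  have sub: "B \<in> I" if "A \<in> I" "finite F" "B \<subseteq> F \<union> A" for A B F
  proof -
    have "F \<in> I" by (rule ideal_on_finite[OF I that(2)]) simp
    then have "F \<union> A \<in> I" using ideal_on_Un[OF I] that(1) by blast
    then show ?thesis using ideal_on_subset[OF I] that(3) by blast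
  qed
  have fin: "finite {n. norm (x - partial_sum u n x) \<ge> \<epsilon>}" if "\<epsilon> > 0" for x and \<epsilon> :: real
  proof -
    have "\<forall>\<^sub>F n in sequentially. dist (partial_sum u n x) x < \<epsilon>"
      using u that by (rule tendstoD)
    then have "\<forall>\<^sub>F n in cofinite. \<not> norm (x - partial_sum u n x) \<ge> \<epsilon>"
      by (simp add: cofinite_eq_sequentially dist_norm norm_minus_commute not_le)
    then show ?thesis by (simp add: eventually_cofinite)
  qed
  have tri: "norm (v + w) < \<epsilon>" if "norm v < \<epsilon> / 2" "norm w < \<epsilon> / 2" for v w :: 'a and \<epsilon>
    using norm_triangle_ineq[of v w] that by simp
  show ?thesis
    unfolding ideal_Schauder_basis_def
  proof (rule iff_allI, rule iffI; intro allI impI)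
    fix x and \<epsilon> :: real assume *: "\<forall>\<epsilon>>0. {n. norm (x - partial_sum a n x) \<ge> \<epsilon>} \<in> I" and \<epsilon>: "0 < \<epsilon>"
    show "{n. norm (partial_sum u n x - partial_sum a n x) \<ge> \<epsilon>} \<in> I"
    proof (rule sub)
      show "{n. norm (x - partial_sum a n x) \<ge> \<epsilon> / 2} \<in> I" using * half_gt_zero[OF \<epsilon>] by blast
      show "finite {n. norm (x - partial_sum u n x) \<ge> \<epsilon> / 2}" by (rule fin) (use \<epsilon> in simp)
      have "norm (partial_sum u n x - partial_sum a n x) < \<epsilon>"
        if "norm (x - partial_sum u n x) < \<epsilon> / 2" "norm (x - partial_sum a n x) < \<epsilon> / 2" for n
        using tri[of "x - partial_sum a n x" \<epsilon> "- (x - partial_sum u n x)"] that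
        by (simp add: norm_minus_commute)
      then show "{n. norm (partial_sum u n x - partial_sum a n x) \<ge> \<epsilon>}
          \<subseteq> {n. norm (x - partial_sum u n x) \<ge> \<epsilon> / 2} \<union> {n. norm (x - partial_sum a n x) \<ge> \<epsilon> / 2}"
        unfolding not_le[symmetric] by blast
    qed
  next
    fix x and \<epsilon> :: real
    assume *: "\<forall>\<epsilon>>0. {n. norm (partial_sum u n x - partial_sum a n x) \<ge> \<epsilon>} \<in> I" and \<epsilon>: "0 < \<epsilon>"
    show "{n. norm (x - partial_sum a n x) \<ge> \<epsilon>} \<in> I"
    proof (rule sub)
      show "{n. norm (partial_sum u n x - partial_sum a n x) \<ge> \<epsilon> / 2} \<in> I" using * half_gt_zero[OF \<epsilon>] by blast
      show "finite {n. norm (x - partial_sum u n x) \<ge> \<epsilon> / 2}" by (rule fin) (use \<epsilon> in simp)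
      have "norm (x - partial_sum a n x) < \<epsilon>"
        if "norm (x - partial_sum u n x) < \<epsilon> / 2"
          "norm (partial_sum u n x - partial_sum a n x) < \<epsilon> / 2" for n
        using tri[OF that] by simp
      then show "{n. norm (x - partial_sum a n x) \<ge> \<epsilon>} \<subseteq> {n. norm (x - partial_sum u n x) \<ge> \<epsilon> / 2}
          \<union> {n. norm (partial_sum u n x - partial_sum a n x) \<ge> \<epsilon> / 2}"
        unfolding not_le[symmetric] by blast
    qed
  qed
qed

text \<open>Where the difference at \<open>x\<close> is at least \<open>\<epsilon>\<close>, the null
  coordinates force the norms of \<open>b (h n)\<close> to infinity, as \<open>h\<close> is
  finite-to-one. Conversely, if the norms tend to infinity along a set, some decreasing null
  sequence of coordinates decays slowly enough to keep the difference large there. Points outside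
  \<open>D\<close>, where there is no difference, go into the fibre over 0, so that sets of the
  ideal contain only finitely many of them.\<close>

lemma critical_ideal_finite_to_one:
  assumes u: "monotone_null_basis u"
    and diff: "\<And>x n. partial_sum u n x - partial_sum a n x =
      (if n \<in> D then scale (snd (u (h n)) x) (b (h n)) else 0)"
    and b: "\<And>k. k \<in> h ` D \<Longrightarrow> b k \<noteq> 0"
    and h: "\<And>k. finite {n \<in> D. h n = k}"
  shows "critical_ideal a = fibre_ideal (\<lambda>n. if n \<in> D then nat \<lfloor>norm (b (h n))\<rfloor> else 0)"
    (is "_ = fibre_ideal ?v")
proof (rule critical_ideal_eqI)
  have null: "(\<lambda>n. snd (u n) x) \<longlonglongrightarrow> 0" for x
    using u by (simp add: monotone_null_basis_def)
  have h_le: "finite {n \<in> D. h n < k}" for k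
  proof -
    have "{n \<in> D. h n < k} = (\<Union>i\<in>{..<k}. {n \<in> D. h n = i})" by auto
    then show ?thesis using h by simp
  qed
  have set_eq: "{n. norm (partial_sum u n x - partial_sum a n x) \<ge> \<epsilon>}
      = {n \<in> D. norm (snd (u (h n)) x) * norm (b (h n)) \<ge> \<epsilon>}" if "\<epsilon> > 0" for x and \<epsilon> :: real
    using that by (auto simp: diff norm_scale)
  have "ideal_Schauder_basis I a \<longleftrightarrow> fibre_ideal ?v \<subseteq> I" if I: "ideal_on UNIV I" for I
  proof -
    have "ideal_Schauder_basis I a \<longleftrightarrow>
        (\<forall>x. \<forall>\<epsilon>>0. {n \<in> D. norm (snd (u (h n)) x) * norm (b (h n)) \<ge> \<epsilon>} \<in> I)"
      using ideal_Schauder_basis_iff_diff[OF _ I, of u a] u set_eq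
      by (simp add: monotone_null_basis_def)
    also have "\<dots> \<longleftrightarrow> fibre_ideal ?v \<subseteq> I"
    proof
      assume basis: "\<forall>x. \<forall>\<epsilon>>0. {n \<in> D. norm (snd (u (h n)) x) * norm (b (h n)) \<ge> \<epsilon>} \<in> I"
      show "fibre_ideal ?v \<subseteq> I"
      proof
        fix A assume A: "A \<in> fibre_ideal ?v"
        show "A \<in> I"
        proof (cases "finite A")
          case True
          then show ?thesis by (rule ideal_on_finite[OF I]) simp
        next
          case inf: False
          \<comment> \<open>The points outside \<open>D\<close> or with norm of
            \<open>b (h n)\<close> below 1: finitely many within \<open>A\<close>, hence
            negligible.\<close>
          define F where "F = {n \<in> A. ?v n \<le> 0}"
          define S where "S = A - F"
          have F: "finite F" unfolding F_def by (rule finite_fibres_le[OF A])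
          have S: "infinite S" using inf F by (simp add: S_def)
          have SD: "n \<in> D" "norm (b (h n)) \<ge> 1" if "n \<in> S" for n
            using that by (auto simp: S_def F_def split: if_splits)
          have "finite {n \<in> S. ?v n \<le> j}" for j
            by (rule finite_subset[OF _ finite_fibres_le[OF A]]) (auto simp: S_def)
          moreover have "finite {n \<in> S. h n < k}" for k
            by (rule finite_subset[OF _ h_le]) (use SD in auto)
          ultimately obtain m where m: "mono m" "filterlim m at_top sequentially"
              "\<And>n. n \<in> S \<Longrightarrow> m (h n) \<le> ?v n"
            using exists_slow_minorant[OF S, of ?v h] by blast
          \<comment> \<open>On \<open>S\<close> the norm of \<open>b (h n)\<close> is at least 1 and
            at least \<open>m (h n)\<close>, so twice the norm dominates
            \<open>Suc (m (h n))\<close>; this yields the threshold \<open>1 / 2\<close>.\<close>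
          define z where "z k = inverse (real (Suc (m k)))" for k
          have "decseq z"
            using m(1) by (auto simp: z_def decseq_def mono_def)
          moreover have "z \<longlonglongrightarrow> 0"
            unfolding z_def by (rule filterlim_compose[OF LIMSEQ_inverse_real_of_nat m(2)])
          ultimately obtain x where x: "\<And>n. snd (u n) x = of_real (z n)"
            using u unfolding monotone_null_basis_def by blast
          have "S \<subseteq> {n \<in> D. norm (snd (u (h n)) x) * norm (b (h n)) \<ge> 1 / 2}"
          proof safe
            fix n assume n: "n \<in> S"
            let ?\<beta> = "norm (b (h n))"
            show "n \<in> D" using SD n by blast
            have "real (m (h n)) \<le> ?\<beta>"
              using m(3)[OF n] SD[OF n] by (simp add: le_nat_iff le_floor_iff)
            then have "real (Suc (m (h n))) \<le> 2 * ?\<beta>" using SD(2)[OF n] by simp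
            then have "1 / 2 \<le> ?\<beta> / real (Suc (m (h n)))" by (simp add: field_simps)
            moreover have "norm (snd (u (h n)) x) = 1 / real (Suc (m (h n)))"
              unfolding x norm_of_real z_def by (simp add: inverse_eq_divide)
            ultimately show "1 / 2 \<le> norm (snd (u (h n)) x) * ?\<beta>" by simp
          qed
          moreover have "{n \<in> D. norm (snd (u (h n)) x) * norm (b (h n)) \<ge> 1 / 2} \<in> I"
            by (rule basis[rule_format]) simp
          ultimately have "S \<in> I" using ideal_on_subset[OF I] by blast
          moreover have "F \<in> I" by (rule ideal_on_finite[OF I F]) simp
          ultimately have "F \<union> S \<in> I" using ideal_on_Un[OF I] by blast
          moreover have "F \<union> S = A" by (auto simp: S_def F_def)
          ultimately show ?thesis by simp
        qed
      qed
    next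
      assume sub: "fibre_ideal ?v \<subseteq> I"
      show "\<forall>x. \<forall>\<epsilon>>0. {n \<in> D. norm (snd (u (h n)) x) * norm (b (h n)) \<ge> \<epsilon>} \<in> I"
      proof (intro allI impI)
        fix x and \<epsilon> :: real assume \<epsilon>: "0 < \<epsilon>"
        let ?A = "{n \<in> D. norm (snd (u (h n)) x) * norm (b (h n)) \<ge> \<epsilon>}"
        have "finite {n \<in> ?A. ?v n = j}" for j
        proof -
          \<comment> \<open>On the fibre over \<open>j\<close> the norm of \<open>b (h n)\<close> is
            at most \<open>j + 1\<close>, so the coordinate must be at least
            \<open>\<epsilon> / (j + 1)\<close>, which confines \<open>h n\<close> below
            \<open>K\<close>.\<close>
          obtain K where K: "\<And>k. k \<ge> K \<Longrightarrow> norm (snd (u k) x) < \<epsilon> / real (Suc j)"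
            using LIMSEQ_D[OF null[of x], of "\<epsilon> / real (Suc j)"] \<epsilon> by auto
          have "{n \<in> ?A. ?v n = j} \<subseteq> {n \<in> D. h n < K}"
          proof safe
            fix n assume n: "n \<in> D" "\<epsilon> \<le> norm (snd (u (h n)) x) * norm (b (h n))"
              and j: "j = ?v n"
            have "norm (b (h n)) \<le> real (Suc j)"
              using n(1) by (simp add: j) linarith
            then have "\<epsilon> \<le> norm (snd (u (h n)) x) * real (Suc j)"
              using n(2) by (meson mult_left_mono norm_ge_zero order_trans)
            then have "\<epsilon> / real (Suc j) \<le> norm (snd (u (h n)) x)"
              by (simp add: field_simps)
            then show "h n < K" using K[of "h n"] by force
          qed
          then show ?thesis using h_le finite_subset by blast
        qed
        then show "?A \<in> I" using sub by (auto simp: fibre_ideal_def)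
      qed
    qed
    finally show ?thesis .
  qed
  then show "is_critical_ideal a (fibre_ideal ?v)"
    by (simp add: is_critical_ideal_def ideal_on_fibre_ideal)
qed

text \<open>An unbounded interval is cofinite. On this fibre the difference at the basis vector of
  index \<open>k\<close> is the fixed nonzero vector \<open>b k\<close>, so the ideal contains a
  cofinite set.\<close>

lemma critical_ideal_infinite_fibre:
  assumes u: "monotone_null_basis u"
    and diff: "\<And>x n. partial_sum u n x - partial_sum a n x =
      (if n \<in> D then scale (snd (u (h n)) x) (b (h n)) else 0)"
    and b: "\<And>k. k \<in> h ` D \<Longrightarrow> b k \<noteq> 0"
    and int: "nat_interval {n \<in> D. h n = k}" and inf: "infinite {n \<in> D. h n = k}"
  shows "critical_ideal a = Pow UNIV"
proof -
  let ?I = "critical_ideal a" and ?S = "{n \<in> D. h n = k}"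
  have I: "ideal_on UNIV ?I" and basis: "ideal_Schauder_basis ?I a"
    using is_critical_ideal_critical_ideal[of a] by (auto simp: is_critical_ideal_def)
  obtain p where p: "p \<in> ?S" using inf by (metis finite.emptyI all_not_in_conv)
  have "n \<in> ?S" if "n \<ge> p" for n
  proof -
    obtain q where "q \<in> ?S" "q > n" using inf unfolding infinite_nat_iff_unbounded by blast
    then have "{p..q} \<subseteq> ?S" using int p unfolding nat_interval_def by blast
    then show ?thesis using that \<open>q > n\<close> by (meson atLeastAtMost_iff less_imp_le subsetD)
  qed
  then have "- ?S \<subseteq> {..<p}" by (meson ComplD lessThan_iff not_le subsetI)
  then have co: "finite (- ?S)" by (rule finite_subset) simp
  have "k \<in> h ` D" using p by blast
  then have bk: "norm (b k) > 0" using b by simp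
  have basis': "\<forall>x. \<forall>\<epsilon>>0. {n. norm (partial_sum u n x - partial_sum a n x) \<ge> \<epsilon>} \<in> ?I"
    using ideal_Schauder_basis_iff_diff[OF _ I, of u a] basis u by (simp add: monotone_null_basis_def)
  have "{n. norm (partial_sum u n (fst (u k)) - partial_sum a n (fst (u k))) \<ge> norm (b k)} \<in> ?I"
    using basis' bk by blast
  moreover have "?S \<subseteq> {n. norm (partial_sum u n (fst (u k)) - partial_sum a n (fst (u k))) \<ge> norm (b k)}"
    using u by (auto simp: diff norm_scale monotone_null_basis_def biorthogonal_def)
  ultimately have "?S \<in> ?I" using ideal_on_subset[OF I] by blast
  moreover have "- ?S \<in> ?I" by (rule ideal_on_finite[OF I co]) simp
  ultimately have "?S \<union> - ?S \<in> ?I" using ideal_on_Un[OF I] by blast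
  then have "UNIV \<in> ?I" by (simp only: Compl_partition)
  then show ?thesis using ideal_on_subset[OF I] by blast
qed

lemma simple_over_imp_fibre_ideal:
  assumes u: "monotone_null_basis u" and a: "simple_over a u" and nontriv: "critical_ideal a \<noteq> Pow UNIV"
  shows "\<exists>v. critical_ideal a = fibre_ideal v"
proof -
  obtain D h b where *: "(\<forall>k. nat_interval {n \<in> D. h n = k}) \<and> (\<forall>k\<in>h ` D. b k \<noteq> 0) \<and>
      (\<forall>x n. partial_sum u n x - partial_sum a n x =
        (if n \<in> D then scale (snd (u (h n)) x) (b (h n)) else 0))"
    using a unfolding simple_over_def by (elim conjE exE) (rule that, intro conjI)
  have int: "nat_interval {n \<in> D. h n = k}" for k using * by (simp only:)
  have b: "b k \<noteq> 0" if "k \<in> h ` D" for k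
    using bspec[OF *[THEN conjunct2, THEN conjunct1] that] .
  have diff: "partial_sum u n x - partial_sum a n x =
      (if n \<in> D then scale (snd (u (h n)) x) (b (h n)) else 0)" for x n
    using * by (simp only:)
  have "finite {n \<in> D. h n = k}" for k
  proof (rule ccontr)
    assume "infinite {n \<in> D. h n = k}"
    from critical_ideal_infinite_fibre[OF u diff b int this] nontriv show False by contradiction
  qed
  from critical_ideal_finite_to_one[OF u diff b this] show ?thesis by (intro exI)
qed

section \<open>Realising a prescribed fibre ideal\<close>

primrec chain_vector :: "(nat \<Rightarrow> 'a \<times> ('a \<Rightarrow> 'k)) \<Rightarrow> (nat \<Rightarrow> nat) \<Rightarrow> nat \<Rightarrow> 'a" where
  "chain_vector u v 0 = fst (u 0)"
| "chain_vector u v (Suc n) =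
     fst (u (Suc n)) + (real (Suc (v n)) / norm (chain_vector u v n)) *\<^sub>R chain_vector u v n"

text \<open>The real factor from the recursion as a scalar of \<open>'k\<close>. It scales the
  \<open>n\<close>-th chain vector, once known to be nonzero, to norm \<open>v n + 1\<close>; the
  added 1 keeps the result nonzero when \<open>v n = 0\<close>.\<close>

definition chain_coeff :: "(nat \<Rightarrow> 'a \<times> ('a \<Rightarrow> 'k)) \<Rightarrow> (nat \<Rightarrow> nat) \<Rightarrow> nat \<Rightarrow> 'k" where
  "chain_coeff u v n = of_real (real (Suc (v n)) / norm (chain_vector u v n))"

definition chain :: "(nat \<Rightarrow> 'a \<times> ('a \<Rightarrow> 'k)) \<Rightarrow> (nat \<Rightarrow> nat) \<Rightarrow> nat \<Rightarrow> 'a \<times> ('a \<Rightarrow> 'k)" where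
  "chain u v n = (chain_vector u v n, \<lambda>x. snd (u n) x - chain_coeff u v n * snd (u (Suc n)) x)"

lemma chain_vector_Suc:
  "chain_vector u v (Suc n) = fst (u (Suc n)) + scale (chain_coeff u v n) (chain_vector u v n)"
  by (simp add: chain_coeff_def scale_of_real del: of_real_divide)

lemma continuous_dual_linear:
  assumes "f \<in> continuous_dual"
  shows "f (x + y) = f x + f y" "f (scale c x) = c * f x"
proof -
  interpret f: Vector_Spaces.linear scale "(*)" f
    using assms by (simp add: continuous_dual_def)
  show "f (x + y) = f x + f y" "f (scale c x) = c * f x" by (simp_all add: f.add f.scale)
qed

text \<open>Simplicity holds with \<open>D = UNIV\<close> and \<open>h = Suc\<close>, where
  \<open>b (Suc n)\<close> is the rescaled \<open>n\<close>-th chain vector, of norm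
  \<open>v n + 1\<close>.\<close>

lemma simple_over_chain:
  assumes u: "monotone_null_basis u"
  shows "simple_over (chain u v) u" "critical_ideal (chain u v) = fibre_ideal v"
proof -
  let ?a = "chain_vector u v" and ?c = "chain_coeff u v"
  have bi: "biorthogonal u" and dual: "range u \<subseteq> UNIV \<times> continuous_dual"
    using u by (simp_all add: monotone_null_basis_def)
  have lin: "snd (u n) (x + y) = snd (u n) x + snd (u n) y" "snd (u n) (scale c x) = c * snd (u n) x"
    and cont: "continuous_on UNIV (snd (u n))" for n x y c
  proof -
    have "snd (u n) \<in> continuous_dual" using dual by (metis mem_Times_iff rangeI subsetD)
    then show "snd (u n) (x + y) = snd (u n) x + snd (u n) y"
      "snd (u n) (scale c x) = c * snd (u n) x" "continuous_on UNIV (snd (u n))"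
      by (simp_all add: continuous_dual_linear) (simp add: continuous_dual_def)
  qed
  have u_u: "snd (u n) (fst (u m)) = (if n = m then 1 else 0)" for n m
    using bi by (simp add: biorthogonal_def)
  have coord_Suc: "snd (u n) (?a (Suc m)) = (if n = Suc m then 1 else 0) + ?c m * snd (u n) (?a m)" for n m
    by (simp add: chain_vector_Suc lin u_u del: chain_vector.simps)
  \<comment> \<open>The chain vectors are unitriangular over \<open>u\<close>: no coordinates beyond
    the diagonal and 1 on it. In particular they are nonzero, so dividing by their norms is
    legitimate.\<close>
  have coord_gt: "snd (u n) (?a m) = 0" if "m < n" for n m
    using that
  proof (induction m)
    case 0 then show ?case by (simp add: u_u)
  next
    case (Suc m) then show ?case unfolding coord_Suc by simp
  qed
  have coord_diag: "snd (u n) (?a n) = 1" for n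
  proof (cases n)
    case 0 then show ?thesis by (simp add: u_u)
  next
    case (Suc m) then show ?thesis by (simp only: coord_Suc coord_gt) simp
  qed
  have f_zero: "snd (u n) 0 = 0" for n using lin(2)[of n 0 0] by simp
  have a_nz: "?a n \<noteq> 0" for n using coord_diag[of n] f_zero[of n] by auto
  \<comment> \<open>Induction along the recursion. For \<open>n = m\<close> the two terms of the
    functional at the next vector are both \<open>?c m\<close> and cancel; for other
    \<open>n\<close> different from \<open>Suc m\<close> it vanishes on the added basis vector, and
    the hypothesis applies.\<close>
  have "snd (chain u v n) (?a m) = (if n = m then 1 else 0)" for n m
  proof (induction m)
    case 0
    show ?case
      by (cases n) (simp_all add: chain_def u_u)
  next
    case (Suc m)
    consider "n = Suc m" | "n = m" | "n \<noteq> m" "n \<noteq> Suc m" by blast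
    then show ?case
    proof cases
      case 1
      then show ?thesis by (simp add: chain_def coord_diag coord_gt del: chain_vector.simps)
    next
      case 2
      then show ?thesis by (simp add: chain_def coord_Suc coord_diag coord_gt del: chain_vector.simps)
    next
      case 3
      then have "snd (chain u v n) (?a (Suc m)) = ?c m * snd (chain u v n) (?a m)"
        by (simp add: chain_def coord_Suc algebra_simps del: chain_vector.simps)
      then show ?thesis using Suc 3 by simp
    qed
  qed
  then have bi_a: "biorthogonal (chain u v)" by (simp add: biorthogonal_def chain_def)
  have "snd (chain u v n) \<in> continuous_dual" for n
  proof -
    have "Vector_Spaces.linear scale (*) (snd (chain u v n))"
      by unfold_locales (simp_all add: chain_def lin algebra_simps)
    moreover have "continuous_on UNIV (snd (chain u v n))"
      unfolding chain_def by (auto intro!: continuous_intros cont)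
    ultimately show ?thesis by (simp add: continuous_dual_def)
  qed
  then have dual_a: "range (chain u v) \<subseteq> UNIV \<times> continuous_dual"
    by (intro image_subsetI) (simp only: mem_Times_iff UNIV_I simp_thms)
  define b where "b k = scale (?c (k - 1)) (?a (k - 1))" for k
  have b_norm: "norm (b (Suc n)) = real (Suc (v n))" for n
    using a_nz[of n] by (simp add: b_def norm_scale chain_coeff_def del: of_real_divide of_nat_Suc)
  \<comment> \<open>Telescoping: the old difference plus the new term of \<open>u\<close> is a
    multiple of the next chain vector, by its recursion; subtracting the new term of the chain
    leaves the correction with \<open>?c (Suc n)\<close>.\<close>
  have diff: "partial_sum u n x - partial_sum (chain u v) n x = scale (snd (u (Suc n)) x) (b (Suc n))" for x n
  proof (induction n)
    case 0
    show ?case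
      by (simp add: partial_sum_def chain_def b_def scale_left_diff_distrib mult.commute)
  next
    case (Suc n)
    have "partial_sum u (Suc n) x - partial_sum (chain u v) (Suc n) x
        = scale (snd (u (Suc n)) x) (b (Suc n))
          + scale (snd (u (Suc n)) x) (fst (u (Suc n)))
          - scale (snd (u (Suc n)) x - ?c (Suc n) * snd (u (Suc (Suc n))) x) (?a (Suc n))"
      using Suc by (simp add: partial_sum_def chain_def algebra_simps del: chain_vector.simps)
    also have "\<dots> = scale (snd (u (Suc n)) x) (?a (Suc n))
          - scale (snd (u (Suc n)) x - ?c (Suc n) * snd (u (Suc (Suc n))) x) (?a (Suc n))"
      by (simp add: chain_vector_Suc b_def scale_right_distrib del: chain_vector.simps)
    also have "\<dots> = scale (snd (u (Suc (Suc n))) x) (b (Suc (Suc n)))"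
      by (simp add: b_def scale_left_diff_distrib mult.commute del: chain_vector.simps)
    finally show ?case .
  qed
  have b_nz: "b k \<noteq> 0" if "k \<in> Suc ` UNIV" for k
    using that b_norm by (metis imageE norm_zero nat.distinct(1) of_nat_eq_0_iff)
  have single: "{n \<in> UNIV. Suc n = k} \<subseteq> {k - 1}" for k by auto
  have int: "nat_interval {n \<in> UNIV. Suc n = k}" for k
    by (auto simp: nat_interval_def)
  have diff': "partial_sum u n x - partial_sum (chain u v) n x =
      (if n \<in> UNIV then scale (snd (u (Suc n)) x) (b (Suc n)) else 0)" for x n
    by (simp add: diff)
  show "simple_over (chain u v) u"
    unfolding simple_over_def
    by (intro conjI bi_a dual_a bi dual exI[of _ UNIV] exI[of _ Suc] exI[of _ b] allI ballI int b_nz diff')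
  have "finite {n \<in> UNIV. Suc n = k}" for k
    using single by (rule finite_subset) simp
  note critical_ideal_finite_to_one[OF u diff' b_nz this]
  then have "critical_ideal (chain u v) = fibre_ideal (\<lambda>n. Suc (v n))"
    by (simp add: b_norm del: of_nat_Suc)
  also have "\<dots> = fibre_ideal v"
  proof -
    have "(\<forall>j. finite {n \<in> A. Suc (v n) = j}) \<longleftrightarrow> (\<forall>j. finite {n \<in> A. v n = j})" for A
    proof
      assume fin: "\<forall>j. finite {n \<in> A. v n = j}"
      show "\<forall>j. finite {n \<in> A. Suc (v n) = j}"
      proof
        fix j show "finite {n \<in> A. Suc (v n) = j}" using fin by (cases j) auto
      qed
    next
      assume fin: "\<forall>j. finite {n \<in> A. Suc (v n) = j}"
      show "\<forall>j. finite {n \<in> A. v n = j}"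
      proof
        fix j show "finite {n \<in> A. v n = j}" using fin[rule_format, of "Suc j"] by simp
      qed
    qed
    then show ?thesis by (simp add: fibre_ideal_def)
  qed
  finally show "critical_ideal (chain u v) = fibre_ideal v" .
qed

text \<open>The right-hand side mentions neither the space nor the basis, whence the equivalence
  between null sequences and the James space.\<close>

lemma critical_ideal_simple_iff:
  assumes "monotone_null_basis u" "I \<noteq> Pow UNIV"
  shows "(\<exists>a. simple_over a u \<and> critical_ideal a = I) \<longleftrightarrow> (\<exists>v. I = fibre_ideal v)"
proof
  assume "\<exists>a. simple_over a u \<and> critical_ideal a = I"
  then show "\<exists>v. I = fibre_ideal v"
    using simple_over_imp_fibre_ideal[OF assms(1)] assms(2) by blast
next
  assume "\<exists>v. I = fibre_ideal v"
  then obtain v where "I = fibre_ideal v" by (rule exE)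
  then have "simple_over (chain u v) u \<and> critical_ideal (chain u v) = I"
    by (simp only: simple_over_chain[OF assms(1)])
  then show "\<exists>a. simple_over a u \<and> critical_ideal a = I" by blast
qed

end


section \<open>The unit vectors of the null sequences and of the James space\<close>

lemma c0_coord_sum: "c0_coord (sum f A) k = (\<Sum>i\<in>A. c0_coord (f i) k)"
  by (induction A rule: infinite_finite_induct) (simp_all add: zero_c0.rep_eq plus_c0.rep_eq)

lemma c0_coord_partial_sum:
  "c0_coord (c0.partial_sum c0_unit n x) k = (if k \<le> n then c0_coord x k else 0)"
  by (simp add: c0.partial_sum_def c0_coord_sum c0_unit_def c0_scale.rep_eq c0_unit_vector.rep_eq
      if_distrib[of "(*) _"] cong: if_cong)

lemma monotone_null_basis_c0_unit:
  "c0.monotone_null_basis (c0_unit :: nat \<Rightarrow> 'k::{real_normed_field,banach} c0 \<times> _)"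
  unfolding c0.monotone_null_basis_def
proof (intro conjI allI impI c0_unit_biorthogonal c0_unit_dual)
  fix x :: "'k c0"
  show "(\<lambda>n. snd (c0_unit n) x) \<longlonglongrightarrow> 0"
    using c0_coord_tendsto[of x] by (simp add: c0_unit_def)
  show "(\<lambda>n. c0.partial_sum c0_unit n x) \<longlonglongrightarrow> x"
    unfolding LIMSEQ_iff
  proof (intro allI impI)
    fix e :: real assume e: "0 < e"
    obtain K where K: "\<And>k. k \<ge> K \<Longrightarrow> norm (c0_coord x k) < e / 2"
      using LIMSEQ_D[OF c0_coord_tendsto[of x], of "e / 2"] e by auto
    have "norm (c0.partial_sum c0_unit n x - x) < e" if "n \<ge> K" for n
    proof -
      have "norm (c0.partial_sum c0_unit n x - x) \<le> e / 2"
      proof (rule norm_c0_le)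
        fix k
        show "norm (c0_coord (c0.partial_sum c0_unit n x - x) k) \<le> e / 2"
          using less_imp_le[OF K[of k]] that e
          by (cases "k \<le> n") (simp_all add: minus_c0.rep_eq c0_coord_partial_sum)
      qed
      then show ?thesis using e by simp
    qed
    then show "\<exists>K. \<forall>n\<ge>K. norm (c0.partial_sum c0_unit n x - x) < e" by blast
  qed
next
  fix z :: "nat \<Rightarrow> real" assume "decseq z \<and> z \<longlonglongrightarrow> 0"
  then have "(\<lambda>n. of_real (z n) :: 'k) \<longlonglongrightarrow> 0"
    using tendsto_of_real[of z 0 sequentially] by simp
  then have "snd (c0_unit n) (Abs_c0 (\<lambda>n. of_real (z n) :: 'k)) = of_real (z n)" for n
    by (simp add: c0_unit_def Abs_c0_inverse)
  then show "\<exists>x :: 'k c0. \<forall>n. snd (c0_unit n) x = of_real (z n)" by blast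
qed

section \<open>The James space\<close>

lemma james_var_lessThan: "james_var x n p = sqrt (\<Sum>i<n. (x (p (Suc i)) - x (p i))\<^sup>2)"
  by (simp add: james_var_def sum.atLeast1_atMost_eq)

text \<open>The quadratic variation is at most the total variation, which telescopes for a monotone
  sequence.\<close>

lemma james_bdd_decseq:
  assumes z: "decseq z" "z \<longlonglongrightarrow> 0"
  shows "bdd_above (james_variations z)"
proof (rule james_bddI)
  fix n p assume p: "strict_mono_on {0..n} (p :: nat \<Rightarrow> nat)"
  have le: "z (p (Suc i)) \<le> z (p i)" if "i < n" for i
    using strict_mono_onD[OF p, of i "Suc i"] that by (intro decseqD[OF z(1)]) simp
  have "james_var z n p = L2_set (\<lambda>i. z (p (Suc i)) - z (p i)) {..<n}"
    by (simp add: james_var_lessThan L2_set_def)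
  also have "\<dots> \<le> (\<Sum>i<n. \<bar>z (p (Suc i)) - z (p i)\<bar>)"
    by (rule L2_set_le_sum_abs)
  also have "\<dots> = (\<Sum>i<n. z (p i) - z (p (Suc i)))"
    by (rule sum.cong) (use le in auto)
  also have "\<dots> = z (p 0) - z (p n)" by (rule sum_lessThan_telescope')
  also have "\<dots> \<le> z 0"
    using decseqD[OF z(1), of 0 "p 0"] decseq_ge[OF z, of "p n"] by simp
  finally show "james_var z n p \<le> z 0" .
qed

lemma james_coord_sum: "james_coord (sum f A) k = (\<Sum>i\<in>A. james_coord (f i) k)"
  by (induction A rule: infinite_finite_induct) (simp_all add: zero_james.rep_eq plus_james.rep_eq)

lemma james_coord_partial_sum:
  "james_coord (james.partial_sum james_unit n x) k = (if k \<le> n then james_coord x k else 0)"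
  by (simp add: james.partial_sum_def james_coord_sum james_unit_def scaleR_james.rep_eq
      james_unit_vector.rep_eq if_distrib[of "(*) _"] cong: if_cong)

text \<open>
  A chain that almost attains the norm leaves almost no variation beyond its last point, since
  any chain beyond that point can be appended to it.
\<close>

lemma james_tail_variation:
  assumes bdd: "bdd_above (james_variations x)" and e: "e > 0"
  obtains N where "\<And>l t. strict_mono_on {0..l} t \<Longrightarrow> t 0 > N \<Longrightarrow>
    (\<Sum>i<l. (x (t (Suc i)) - x (t i))\<^sup>2) \<le> e"
proof -
  let ?S = "Sup (james_variations x)"
  have append: "(\<Sum>i<m + l. g i) = (\<Sum>i<m. g i) + (\<Sum>i<l. g (m + i))" for g :: "nat \<Rightarrow> real" and m l
    by (induction l) simp_all
  let ?s = "\<lambda>n p. \<Sum>i<n. (x (p (Suc i)) - x (p i))\<^sup>2"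
  have le: "?s n p \<le> ?S\<^sup>2" if "strict_mono_on {0..n} p" for n p
  proof (rule sqrt_le_D)
    show "sqrt (?s n p) \<le> ?S"
      using james_var_le_Sup[OF bdd that] by (simp add: james_var_lessThan)
  qed
  have "james_var x 0 (\<lambda>i. i) \<le> ?S"
    by (rule james_var_le_Sup[OF bdd], rule strict_mono_onI) simp
  then have "0 \<le> ?S" by (simp add: james_var_def)
  \<comment> \<open>Squares are compared because they add up when chains are joined. Should
    \<open>e\<close> exceed the square of \<open>?S\<close>, the root is negative,
    \<open>sqrt\<close> being odd, and the bound persists.\<close>
  then have "sqrt (?S\<^sup>2 - e) < ?S"
    using e real_sqrt_less_mono[of "?S\<^sup>2 - e" "?S\<^sup>2"] by simp
  then obtain n q where q: "strict_mono_on {0..n} q" "sqrt (?S\<^sup>2 - e) < james_var x n q"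
    using less_cSupD[OF james_variations_nonempty] unfolding james_variations_def by blast
  then have big: "?S\<^sup>2 - e < ?s n q" by (simp add: james_var_lessThan)
  have "?s l t \<le> e" if t: "strict_mono_on {0..l} t" "t 0 > q n" for l t
  proof -
    \<comment> \<open>The chain \<open>q\<close> has \<open>n + 1\<close> points, hence the shift;
      the jump from \<open>q n\<close> to \<open>t 0\<close> adds one nonnegative square, which is
      dropped below.\<close>
    define r where "r i = (if i \<le> n then q i else t (i - Suc n))" for i
    have "strict_mono_on {0..Suc n + l} r"
    proof (rule strict_mono_onI)
      fix i j assume ij: "i \<in> {0..Suc n + l}" "j \<in> {0..Suc n + l}" "i < j"
      consider "j \<le> n" | "i \<le> n" "j > n" | "i > n" using ij by linarith
      then show "r i < r j"
      proof cases
        case 1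
        then show ?thesis using ij strict_mono_onD[OF q(1), of i j] by (simp add: r_def)
      next
        case 2
        have "q i \<le> q n" using strict_mono_on_leD[OF q(1), of i n] 2 by simp
        moreover have "t 0 \<le> t (j - Suc n)"
          using strict_mono_on_leD[OF t(1), of 0 "j - Suc n"] 2 ij by simp
        ultimately show ?thesis using t(2) 2 by (simp add: r_def)
      next
        case 3
        then show ?thesis
          using ij strict_mono_onD[OF t(1), of "i - Suc n" "j - Suc n"] by (simp add: r_def)
      qed
    qed
    then have "?s (Suc n + l) r \<le> ?S\<^sup>2" by (rule le)
    moreover have "?s (Suc n + l) r = ?s (Suc n) r + (\<Sum>i<l. (x (r (Suc (Suc n + i))) - x (r (Suc n + i)))\<^sup>2)"
      by (rule append)
    moreover have "(\<Sum>i<l. (x (r (Suc (Suc n + i))) - x (r (Suc n + i)))\<^sup>2) = ?s l t"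
      by (simp add: r_def)
    moreover have "?s n q \<le> ?s (Suc n) r"
      by (simp add: r_def)
    ultimately show ?thesis using big by linarith
  qed
  then show thesis using that by blast
qed

text \<open>A chain crosses the cut at most once. Steps before the crossing contribute nothing, the
  crossing itself one square of an entry, and the steps after it a variation of the tail; the last
  two are at most \<open>e\<close> each.\<close>

lemma james_var_cutoff_le:
  fixes x y :: "nat \<Rightarrow> real"
  assumes tail: "\<And>l t. strict_mono_on {0..l} t \<Longrightarrow> t 0 > n \<Longrightarrow>
      (\<Sum>i<l. (x (t (Suc i)) - x (t i))\<^sup>2) \<le> e"
    and small: "\<And>k. k > n \<Longrightarrow> (x k)\<^sup>2 \<le> e" and e: "e \<ge> 0"
    and p: "strict_mono_on {0..l} p"
    and y: "\<And>k. y k = (if k \<le> n then 0 else x k)"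
  shows "(\<Sum>i<l. (y (p (Suc i)) - y (p i))\<^sup>2) \<le> 2 * e"
proof -
  have beyond: "(\<Sum>i<l. (y (p (Suc i)) - y (p i))\<^sup>2) \<le> e"
    if p: "strict_mono_on {0..l} p" and p0: "p 0 > n" for l p
  proof -
    have "\<not> p i \<le> n" if "i \<le> l" for i
      using strict_mono_on_leD[OF p, of 0 i] that p0 by simp
    then have "(\<Sum>i<l. (y (p (Suc i)) - y (p i))\<^sup>2) = (\<Sum>i<l. (x (p (Suc i)) - x (p i))\<^sup>2)"
      by (intro sum.cong refl) (simp add: y)
    then show ?thesis using tail[OF p p0] by simp
  qed
  show ?thesis using p
  proof (induction l arbitrary: p)
    case 0
    then show ?case using e by simp
  next
    case (Suc l)
    have shift: "strict_mono_on {0..l} (\<lambda>i. p (Suc i))"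
      using Suc.prems by (auto simp: strict_mono_on_def)
    have split: "(\<Sum>i<Suc l. (y (p (Suc i)) - y (p i))\<^sup>2) =
        (y (p (Suc 0)) - y (p 0))\<^sup>2 + (\<Sum>i<l. (y (p (Suc (Suc i))) - y (p (Suc i)))\<^sup>2)"
      by (rule sum.lessThan_Suc_shift)
    consider "p 0 > n" | "p 0 \<le> n" "p (Suc 0) > n" | "p 0 \<le> n" "p (Suc 0) \<le> n" by linarith
    then show ?case
    proof cases
      case 1
      then show ?thesis using beyond[OF Suc.prems] e by simp
    next
      case 2
      then show ?thesis unfolding split
        using beyond[OF shift] small[of "p (Suc 0)"] by (simp add: y not_le)
    next
      case 3
      then show ?thesis unfolding split using Suc.IH[OF shift] by (simp add: y)
    qed
  qed
qed

lemma monotone_null_basis_james_unit: "james.monotone_null_basis james_unit"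
  unfolding james.monotone_null_basis_def
proof (intro conjI allI impI james_unit_biorthogonal james_unit_dual)
  fix x
  show "(\<lambda>n. snd (james_unit n) x) \<longlonglongrightarrow> 0"
    using james_coord_tendsto[of x] by (simp add: james_unit_def)
  show "(\<lambda>n. james.partial_sum james_unit n x) \<longlonglongrightarrow> x"
    unfolding LIMSEQ_iff
  proof (intro allI impI)
    fix e :: real assume e: "0 < e"
    define d where "d = e / 2"
    have d: "0 < d" using e by (simp add: d_def)
    \<comment> \<open>Since the square of \<open>d / 2\<close> is at most half the square of
      \<open>d\<close>, entries and tail variation obey the same bound, and doubling it gives
      exactly the square of \<open>d\<close>.\<close>
    obtain K where K: "\<And>k. k \<ge> K \<Longrightarrow> \<bar>james_coord x k\<bar> < d / 2"
      using LIMSEQ_D[OF james_coord_tendsto[of x], of "d / 2"] d by auto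
    obtain N where N: "\<And>l t. strict_mono_on {0..l} t \<Longrightarrow> t 0 > N \<Longrightarrow>
        (\<Sum>i<l. (james_coord x (t (Suc i)) - james_coord x (t i))\<^sup>2) \<le> d\<^sup>2 / 2"
      using james_tail_variation[OF james_coord_bdd[of x], of "d\<^sup>2 / 2"] d by (auto simp: zero_less_power)
    have "norm (james.partial_sum james_unit n x - x) < e" if n: "n \<ge> max K N" for n
    proof -
      have "norm (x - james.partial_sum james_unit n x) \<le> d"
        unfolding norm_james.rep_eq
      proof (rule james_Sup_le)
        fix l p assume p: "strict_mono_on {0..l} (p :: nat \<Rightarrow> nat)"
        let ?y = "james_coord (x - james.partial_sum james_unit n x)"
        have "(\<Sum>i<l. (?y (p (Suc i)) - ?y (p i))\<^sup>2) \<le> 2 * (d\<^sup>2 / 2)"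
        proof (rule james_var_cutoff_le[where n = n and x = "james_coord x", OF _ _ _ p])
          show "(\<Sum>i<l. (james_coord x (t (Suc i)) - james_coord x (t i))\<^sup>2) \<le> d\<^sup>2 / 2"
            if "strict_mono_on {0..l} t" "t 0 > n" for l t
            using N[OF that(1)] that(2) n by simp
          show "(james_coord x k)\<^sup>2 \<le> d\<^sup>2 / 2" if "k > n" for k
          proof -
            have "\<bar>james_coord x k\<bar> \<le> d / 2" using K[of k] that n by simp
            then have "(james_coord x k)\<^sup>2 \<le> (d / 2)\<^sup>2"
              using d by (intro abs_le_square_iff[THEN iffD1]) simp
            also have "\<dots> \<le> d\<^sup>2 / 2" by (simp add: power_divide)
            finally show ?thesis .
          qed
        qed (simp_all add: minus_james.rep_eq james_coord_partial_sum)
        then have "james_var ?y l p \<le> sqrt (2 * (d\<^sup>2 / 2))"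
          unfolding james_var_lessThan by (rule real_sqrt_le_mono)
        then show "james_var ?y l p \<le> d" using d by simp
      qed
      then show ?thesis using e by (simp add: d_def norm_minus_commute)
    qed
    then show "\<exists>K. \<forall>n\<ge>K. norm (james.partial_sum james_unit n x - x) < e" by blast
  qed
next
  fix z :: "nat \<Rightarrow> real" assume z: "decseq z \<and> z \<longlonglongrightarrow> 0"
  then have "snd (james_unit n) (Abs_james z) = of_real (z n)" for n
    by (simp add: james_unit_def Abs_james_inverse james_bdd_decseq)
  then show "\<exists>x. \<forall>n. snd (james_unit n) x = of_real (z n)" by blast
qed

theorem theorem6p5:
  fixes I :: "nat set set"
  assumes "ideal_on UNIV I" and "I \<noteq> Pow UNIV"
  shows "((\<exists>a :: nat \<Rightarrow> 'k c0 \<times> ('k c0 \<Rightarrow> 'k::{real_normed_field,banach}).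
             c0.simple_over a c0_unit \<and> c0.critical_ideal a = I)
          \<longleftrightarrow> (\<exists>a :: nat \<Rightarrow> james \<times> (james \<Rightarrow> real).
             james.simple_over a james_unit \<and> james.critical_ideal a = I))
       \<and> ((\<exists>a :: nat \<Rightarrow> james \<times> (james \<Rightarrow> real).
             james.simple_over a james_unit \<and> james.critical_ideal a = I)
          \<longleftrightarrow> (ideal_isomorphic UNIV I UNIV Fin_ideal
             \<or> ideal_isomorphic UNIV I ({0, 1} \<times> UNIV) Fin_oplus_Pow
             \<or> ideal_isomorphic UNIV I UNIV empty_otimes_Fin))"
  \<comment> \<open>Both existence statements turn into
    \<open>\<exists>v. I = fibre_ideal v\<close>, and this into the list of three isomorphism
    types.\<close>
  unfolding c0.critical_ideal_simple_iff[OF monotone_null_basis_c0_unit assms(2)]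
    james.critical_ideal_simple_iff[OF monotone_null_basis_james_unit assms(2)]
    fibre_ideal_iff[OF assms(2)]
  by simp

end
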